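(* Let $\mu\in\mathbb{C}$, $\mu\neq0$, $\mu\notin\{\pm\frac12,\pm1,\pm\frac32,\pm2,\pm3\}$. Let $y=y(x)$ be a (branch of a) solution of $PVI_\mu$, let $k_0\in\mathbb{C}\setminus\{0\}$, and for pairwise distinct $u_1,u_2,u_3$ put $x=\frac{u_3-u_1}{u_2-u_1}$, $H=u_2-u_1$. With the functions $f(x,H)$ and $a,b,b_1,a_1,b_2,c$ of $x$ defined from $y$ and $\frac{dy}{dx}$ in the context, set $$t^1=u_1+a(x)H,\qquad t^2=\frac{1}{1+\mu}\,b(x)\,\frac{H}{f(x,H)},\qquad t^3=\frac1{1+2\mu}\,c(x)\,\frac{H}{f(x,H)^2},$$ $$F=\frac12t^1(t^2)^2+\frac12(t^1)^2t^3+\left[\frac{a_1(x)c(x)^2}{2(1-2\mu)(3+2\mu)}+\frac{(\mu+4)\,b(x)b_1(x)c(x)}{2(1-\mu)(2+\mu)(3+2\mu)}+\frac{b(x)^2(b_2(x)-a(x))}{(2+\mu)(3+2\mu)}\right]\frac{H^3}{f(x,H)^2}.$$ Then, locally near any point $(u_1,u_2,u_3)$ at which these expressions are holomorphic and $E_{11}E_{21}E_{31}\neq0$, these formulae are a parametric representation of a solution $F=F(t^1,t^2,t^3)$ of the WDVV equations, with $d=-2\mu$ and charges $(q_1,q_2,q_3)=(0,-\mu,-2\mu)$. In particular $$t^2=\tau_2(x)H^{1+\mu},\qquad t^3=\tau_3(x)H^{1+2\mu},\qquad F=\tfrac12t^1(t^2)^2+\tfrac12(t^1)^2t^3+\mathcal{F}(x)H^{3+2\mu}$$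 for functions $\tau_2,\tau_3,\mathcal F$ of $x$ alone.
   Context: $PVI_\mu$ is the Painlevé VI equation $$\frac{d^2y}{dx^2}=\frac12\left[\frac1y+\frac1{y-1}+\frac1{y-x}\right]\left(\frac{dy}{dx}\right)^2-\left[\frac1x+\frac1{x-1}+\frac1{y-x}\right]\frac{dy}{dx}+\frac12\,\frac{y(y-1)(y-x)}{x^2(x-1)^2}\left[(2\mu-1)^2+\frac{x(x-1)}{(y-x)^2}\right].$$ WDVV equations (here in dimension 3, $\eta_{\alpha\beta}=\delta_{\alpha+\beta,4}$, $(\eta^{\alpha\beta})=(\eta_{\alpha\beta})^{-1}$, $\partial_\alpha=\partial/\partial t^\alpha$): for all $\alpha,\beta,\gamma,\delta$, $\partial_\alpha\partial_\beta\partial_\lambda F\,\eta^{\lambda\nu}\,\partial_\nu\partial_\gamma\partial_\delta F$ (summed over $\lambda,\nu$) is symmetric under exchange of $\alpha$ and $\delta$; $\partial_1\partial_\alpha\partial_\beta F=\eta_{\alpha\beta}$; and quasi-homogeneity $\sum_\alpha(1-q_\alpha)t^\alpha\partial_\alpha F=(3-d)F$ up to at most quadratic terms. Definitions from $y$. Put $A(x)=\frac12\left[\frac{dy}{dx}x(x-1)-y(y-1)\right]$ and $$\Omega_1=i\frac{\sqrt{y-1}\sqrt{y-x}}{\sqrt x}\left[\frac{A}{(y-1)(y-x)}+\mu\right],\quad\Omega_2=i\frac{\sqrt y\sqrt{y-x}}{\sqrt{1-x}}\left[\frac{A}{y(y-x)}+\mu\right],\quad\Omega_3=-\frac{\sqrt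 y\sqrt{y-1}}{\sqrt x\sqrt{1-x}}\left[\frac{A}{y(y-1)}+\mu\right]$$ (the same, arbitrarily chosen, branch of each square root is used throughout). Put $$E_{i2}=\frac{\Omega_i}{i\mu}\ (i=1,2,3),\quad E_{11}=\frac{\Omega_1\Omega_2-\mu\Omega_3}{2\mu^2},\quad E_{21}=-\frac{\Omega_1^2+\Omega_3^2}{2\mu^2},\quad E_{31}=\frac{\Omega_2\Omega_3+\mu\Omega_1}{2\mu^2},$$ $$E_{13}=-\frac{\Omega_1\Omega_2+\mu\Omega_3}{\Omega_1^2+\Omega_3^2},\quad E_{23}=1,\quad E_{33}=-\frac{\Omega_2\Omega_3-\mu\Omega_1}{\Omega_1^2+\Omega_3^2},$$ $$k(x,H)=\frac{k_0\exp\left\{(2\mu-1)\int^xd\zeta\,\frac{y(\zeta)-\zeta}{\zeta(\zeta-1)}\right\}}{H^{2\mu-1}},\qquad f(x,H)=\frac{\sqrt{k}\,\sqrt{y-1}}{\sqrt H\,\sqrt{x-1}}\quad(\sqrt{1-x}=i\sqrt{x-1}),$$ $$a=E_{21}E_{23}+xE_{31}E_{33},\quad b=E_{22}E_{21}+xE_{32}E_{31},\quad b_1=E_{23}E_{22}+xE_{33}E_{32},$$ $$a_1=E_{23}^2+xE_{33}^2,\quad b_2=E_{22}^2+xE_{32}^2,\quad c=E_{21}^2+xE_{31}^2.$$ *)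

theory Defs
  imports "HOL-Analysis.Analysis"
begin

definition cholomorphic_on :: "(complex ^ 'n \<Rightarrow> complex) \<Rightarrow> (complex ^ 'n) set \<Rightarrow> bool" where
  "cholomorphic_on f S \<longleftrightarrow>
     (\<forall>t\<in>S. \<exists>D. (f has_derivative D) (at t) \<and> (\<forall>c v. D (c *s v) = c * D v))"

definition biholomorphic_on ::
    "(complex ^ 'n \<Rightarrow> complex ^ 'n) \<Rightarrow> (complex ^ 'n) set \<Rightarrow> bool" where
  "biholomorphic_on f U \<longleftrightarrow>
     open U \<and> open (f ` U) \<and> inj_on f U \<and>
     (\<forall>i. cholomorphic_on (\<lambda>u. f u $ i) U) \<and>
     (\<forall>i. cholomorphic_on (\<lambda>t. the_inv_into U f t $ i) (f ` U))"

definition pd :: "'n \<Rightarrow> (complex ^ 'n \<Rightarrow> complex) \<Rightarrow> complex ^ 'n \<Rightarrow> complex" where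
  "pd \<alpha> F t = deriv (\<lambda>z. F (t + axis \<alpha> z)) 0"

text \<open>The antidiagonal matrix, with entry 1 at (1,3), (2,2), (3,1). (The index type is cyclic, so
  addition of indices is avoided.)\<close>

definition eta :: "complex ^ 3 ^ 3" where
  "eta = vector [vector [0, 0, 1], vector [0, 1, 0], vector [1, 0, 0]]"

definition WDVV_contraction ::
    "(complex ^ 3 \<Rightarrow> complex) \<Rightarrow> complex ^ 3 \<Rightarrow> 3 \<Rightarrow> 3 \<Rightarrow> 3 \<Rightarrow> 3 \<Rightarrow> complex" where
  "WDVV_contraction F t \<alpha> \<beta> \<gamma> \<delta> =
     (\<Sum>\<kappa>\<in>UNIV. \<Sum>\<nu>\<in>UNIV.
        pd \<alpha> (pd \<beta> (pd \<kappa> F)) t * matrix_inv eta $ \<kappa> $ \<nu> * pd \<nu> (pd \<gamma> (pd \<delta> F)) t)"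

definition quadratic_polynomial :: "(complex ^ 3 \<Rightarrow> complex) \<Rightarrow> bool" where
  "quadratic_polynomial Q \<longleftrightarrow>
     (\<exists>A B C. Q = (\<lambda>t. (\<Sum>\<alpha>\<in>UNIV. \<Sum>\<beta>\<in>UNIV. A \<alpha> \<beta> * t $ \<alpha> * t $ \<beta>) + (\<Sum>\<alpha>\<in>UNIV. B \<alpha> * t $ \<alpha>) + C))"

definition WDVV_solution ::
    "complex \<Rightarrow> complex ^ 3 \<Rightarrow> (complex ^ 3) set \<Rightarrow> (complex ^ 3 \<Rightarrow> complex) \<Rightarrow> bool" where
  "WDVV_solution d q T F \<longleftrightarrow>
     open T \<and> cholomorphic_on F T \<and>
     (\<forall>t\<in>T. \<forall>\<alpha> \<beta> \<gamma> \<delta>. WDVV_contraction F t \<alpha> \<beta> \<gamma> \<delta> = WDVV_contraction F t \<delta> \<beta> \<gamma> \<alpha>) \<and>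
     (\<forall>t\<in>T. \<forall>\<alpha> \<beta>. pd 1 (pd \<alpha> (pd \<beta> F)) t = eta $ \<alpha> $ \<beta>) \<and>
     (\<exists>Q. quadratic_polynomial Q \<and>
        (\<forall>t\<in>T. (\<Sum>\<alpha>\<in>UNIV. (1 - q $ \<alpha>) * t $ \<alpha> * pd \<alpha> F t) = (3 - d) * F t + Q t))"

definition PVI_solution_on :: "complex \<Rightarrow> complex set \<Rightarrow> (complex \<Rightarrow> complex) \<Rightarrow> bool" where
  "PVI_solution_on \<mu> X y \<longleftrightarrow>
     open X \<and> 0 \<notin> X \<and> 1 \<notin> X \<and> y holomorphic_on X \<and>
     (\<forall>x\<in>X. y x \<noteq> 0 \<and> y x \<noteq> 1 \<and> y x \<noteq> x \<and>
        deriv (deriv y) x =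
          1/2 * (1 / y x + 1 / (y x - 1) + 1 / (y x - x)) * (deriv y x)\<^sup>2
          - (1 / x + 1 / (x - 1) + 1 / (y x - x)) * deriv y x
          + 1/2 * (y x * (y x - 1) * (y x - x)) / (x\<^sup>2 * (x - 1)\<^sup>2)
              * ((2 * \<mu> - 1)\<^sup>2 + x * (x - 1) / (y x - x)\<^sup>2))"

text \<open>The multivalued ingredients of the formulae: branches of the square roots of
  x, 1 - x, y, y - 1, y - x (as functions of x), of the logarithm and the square root of H,
  a primitive of (y - x) / (x (x - 1)), and a branch of the square root of k as a function of (x, H).
  All powers of H are taken with the same logarithm.\<close>

record branches =
  sqrt_x :: "complex \<Rightarrow> complex"
  sqrt_1x :: "complex \<Rightarrow> complex"
  sqrt_y :: "complex \<Rightarrow> complex"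
  sqrt_y1 :: "complex \<Rightarrow> complex"
  sqrt_yx :: "complex \<Rightarrow> complex"
  log_H :: "complex \<Rightarrow> complex"
  sqrt_H :: "complex \<Rightarrow> complex"
  prim :: "complex \<Rightarrow> complex"
  sqrt_k :: "complex \<times> complex \<Rightarrow> complex"

definition sqrt_branch ::
    "'a::topological_space set \<Rightarrow> ('a \<Rightarrow> complex) \<Rightarrow> ('a \<Rightarrow> complex) \<Rightarrow> bool" where
  "sqrt_branch S g r \<longleftrightarrow> continuous_on S r \<and> (\<forall>z\<in>S. (r z)\<^sup>2 = g z)"

definition H_power :: "branches \<Rightarrow> complex \<Rightarrow> complex \<Rightarrow> complex" where
  "H_power B H s = exp (s * log_H B H)"

definition kfun :: "complex \<Rightarrow> complex \<Rightarrow> branches \<Rightarrow> complex \<Rightarrow> complex \<Rightarrow> complex" where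
  "kfun \<mu> k0 B x H = k0 * exp ((2 * \<mu> - 1) * prim B x) / H_power B H (2 * \<mu> - 1)"

definition admissible_branches ::
    "complex \<Rightarrow> complex \<Rightarrow> (complex \<Rightarrow> complex) \<Rightarrow> complex set \<Rightarrow> complex set \<Rightarrow> branches \<Rightarrow> bool" where
  "admissible_branches \<mu> k0 y X L B \<longleftrightarrow>
     sqrt_branch X (\<lambda>x. x) (sqrt_x B) \<and>
     sqrt_branch X (\<lambda>x. 1 - x) (sqrt_1x B) \<and>
     sqrt_branch X y (sqrt_y B) \<and>
     sqrt_branch X (\<lambda>x. y x - 1) (sqrt_y1 B) \<and>
     sqrt_branch X (\<lambda>x. y x - x) (sqrt_yx B) \<and>
     continuous_on L (log_H B) \<and> (\<forall>H\<in>L. exp (log_H B H) = H) \<and>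
     sqrt_branch L (\<lambda>H. H) (sqrt_H B) \<and>
     (\<forall>x\<in>X. (prim B has_field_derivative (y x - x) / (x * (x - 1))) (at x)) \<and>
     sqrt_branch (X \<times> L) (\<lambda>(x, H). kfun \<mu> k0 B x H) (sqrt_k B)"

context
  fixes \<mu> :: complex and y :: "complex \<Rightarrow> complex" and B :: branches
begin

definition Afun :: "complex \<Rightarrow> complex" where
  "Afun x = 1/2 * (deriv y x * x * (x - 1) - y x * (y x - 1))"

definition Omega1 :: "complex \<Rightarrow> complex" where
  "Omega1 x = \<i> * (sqrt_y1 B x * sqrt_yx B x / sqrt_x B x) * (Afun x / ((y x - 1) * (y x - x)) + \<mu>)"

definition Omega2 :: "complex \<Rightarrow> complex" where
  "Omega2 x = \<i> * (sqrt_y B x * sqrt_yx B x / sqrt_1x B x) * (Afun x / (y x * (y x - x)) + \<mu>)"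

definition Omega3 :: "complex \<Rightarrow> complex" where
  "Omega3 x = - (sqrt_y B x * sqrt_y1 B x / (sqrt_x B x * sqrt_1x B x)) * (Afun x / (y x * (y x - 1)) + \<mu>)"

definition E :: "complex \<Rightarrow> complex ^ 3 ^ 3" where
  "E x = (let \<Omega>1 = Omega1 x; \<Omega>2 = Omega2 x; \<Omega>3 = Omega3 x in
     vector [
       vector [(\<Omega>1 * \<Omega>2 - \<mu> * \<Omega>3) / (2 * \<mu>\<^sup>2), \<Omega>1 / (\<i> * \<mu>), - (\<Omega>1 * \<Omega>2 + \<mu> * \<Omega>3) / (\<Omega>1\<^sup>2 + \<Omega>3\<^sup>2)],
       vector [- (\<Omega>1\<^sup>2 + \<Omega>3\<^sup>2) / (2 * \<mu>\<^sup>2), \<Omega>2 / (\<i> * \<mu>), 1],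
       vector [(\<Omega>2 * \<Omega>3 + \<mu> * \<Omega>1) / (2 * \<mu>\<^sup>2), \<Omega>3 / (\<i> * \<mu>), - (\<Omega>2 * \<Omega>3 - \<mu> * \<Omega>1) / (\<Omega>1\<^sup>2 + \<Omega>3\<^sup>2)]])"

definition coef_a :: "complex \<Rightarrow> complex" where
  "coef_a x = E x $ 2 $ 1 * E x $ 2 $ 3 + x * E x $ 3 $ 1 * E x $ 3 $ 3"

definition coef_b :: "complex \<Rightarrow> complex" where
  "coef_b x = E x $ 2 $ 2 * E x $ 2 $ 1 + x * E x $ 3 $ 2 * E x $ 3 $ 1"

definition coef_b1 :: "complex \<Rightarrow> complex" where
  "coef_b1 x = E x $ 2 $ 3 * E x $ 2 $ 2 + x * E x $ 3 $ 3 * E x $ 3 $ 2"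

definition coef_a1 :: "complex \<Rightarrow> complex" where
  "coef_a1 x = (E x $ 2 $ 3)\<^sup>2 + x * (E x $ 3 $ 3)\<^sup>2"

definition coef_b2 :: "complex \<Rightarrow> complex" where
  "coef_b2 x = (E x $ 2 $ 2)\<^sup>2 + x * (E x $ 3 $ 2)\<^sup>2"

definition coef_c :: "complex \<Rightarrow> complex" where
  "coef_c x = (E x $ 2 $ 1)\<^sup>2 + x * (E x $ 3 $ 1)\<^sup>2"

end

text \<open>The convention sqrt (1 - x) = i sqrt (x - 1) determines the root of x - 1.\<close>

definition ffun :: "branches \<Rightarrow> complex \<Rightarrow> complex \<Rightarrow> complex" where
  "ffun B x H = sqrt_k B (x, H) * sqrt_y1 B x / (sqrt_H B H * (sqrt_1x B x / \<i>))"

definition ratio :: "complex ^ 3 \<Rightarrow> complex" where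
  "ratio u = (u $ 3 - u $ 1) / (u $ 2 - u $ 1)"

definition diff21 :: "complex ^ 3 \<Rightarrow> complex" where
  "diff21 u = u $ 2 - u $ 1"

definition flat_coords ::
    "complex \<Rightarrow> (complex \<Rightarrow> complex) \<Rightarrow> branches \<Rightarrow> complex ^ 3 \<Rightarrow> complex ^ 3" where
  "flat_coords \<mu> y B u = (let x = ratio u; H = diff21 u; f = ffun B x H in
     vector [
       u $ 1 + coef_a \<mu> y B x * H,
       1 / (1 + \<mu>) * coef_b \<mu> y B x * (H / f),
       1 / (1 + 2 * \<mu>) * coef_c \<mu> y B x * (H / f\<^sup>2)])"

definition potential ::
    "complex \<Rightarrow> (complex \<Rightarrow> complex) \<Rightarrow> branches \<Rightarrow> complex ^ 3 \<Rightarrow> complex" where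
  "potential \<mu> y B u = (let x = ratio u; H = diff21 u; f = ffun B x H; t = flat_coords \<mu> y B u;
       a = coef_a \<mu> y B x; b = coef_b \<mu> y B x; b1 = coef_b1 \<mu> y B x;
       a1 = coef_a1 \<mu> y B x; b2 = coef_b2 \<mu> y B x; c = coef_c \<mu> y B x in
     1/2 * t $ 1 * (t $ 2)\<^sup>2 + 1/2 * (t $ 1)\<^sup>2 * t $ 3
     + (a1 * c\<^sup>2 / (2 * (1 - 2 * \<mu>) * (3 + 2 * \<mu>))
        + (\<mu> + 4) * b * b1 * c / (2 * (1 - \<mu>) * (2 + \<mu>) * (3 + 2 * \<mu>))
        + b\<^sup>2 * (b2 - a) / ((2 + \<mu>) * (3 + 2 * \<mu>))) * (H ^ 3 / f\<^sup>2))"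

end

(* Put V = [[0, -\<Omega>3, \<Omega>2], [\<Omega>3, 0, -\<Omega>1], [-\<Omega>2, \<Omega>1, 0]].  PVI for y says exactly that x (x - 1) A' is a quadratic
   polynomial in A, and this turns into \<Omega>1' = \<Omega>2 \<Omega>3 / x, \<Omega>2' = \<Omega>1 \<Omega>3 / (1 - x), \<Omega>3' = \<Omega>1 \<Omega>2 / (x (x - 1));
   moreover \<Omega>1^2 + \<Omega>2^2 + \<Omega>3^2 = -\<mu>^2 identically.  The columns of E are eigenvectors of V for \<mu>, 0, -\<mu>, with
   E^T E = \<eta>.  After rescaling the outer columns by f and 1 / f they form a frame \<psi>(u) with
   d\<psi>_j = sum_k \<gamma>_jk \<psi>_k (du_k - du_j), where \<gamma>_jk = V_jk / (u_k - u_j) is symmetric.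

   For such a frame S_ab = sum_j u_j \<psi>_ja \<psi>_jb satisfies dS_ab = (1 + m_a + m_b) sum_j \<psi>_ja \<psi>_jb du_j with
   m = (\<mu>, 0, -\<mu>), so suitable multiples of the S_ab are the Hessian of a potential in the flat coordinates
   t^a = S_{1,4-a} / (1 + m_1 - m_a).  Euler's identity, applied twice, gives first the gradient and then F itself in
   terms of the S_ab.  The third derivatives of F are sum_j \<psi>_ja \<psi>_jb \<psi>_jc / \<psi>_j1, for which WDVV is immediate. *)
theory Submission
  imports Defs "HOL-Complex_Analysis.Cauchy_Integral_Formula"
begin

section \<open>Orthogonal frames and the WDVV equations\<close>

text \<open>The frame equation splits into the directions dH/H and dx. Along dH/H it is the
  eigenvector equation of V, so column \<alpha> has to carry the power of H whose exponent is its
  eigenvalue. Along dx it fixes the scalar by which each eigencolumn may still be multiplied: since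
  E23 = 1, the second entry of the third column is that scalar itself, and the equation reads f'/f =
  - \<Omega>1 E33 / (x - 1). The exponential in k together with the root of (y - 1) / (x - 1) is its
  solution; the pairing of the outer columns then forces 1/f on the first one.

  Gradient and potential arise by dividing by a degree of homogeneity, not by integrating closed
  forms, so the shape of the neighbourhood never matters; the excluded values of \<mu> keep these
  degrees nonzero. E21 \<noteq> 0 makes E13 and E33 meaningful, and all three E_j1 occur as
  denominators in the inverse Jacobian.

  The roots are only continuous branches on possibly disconnected sets. Their differentiability, and
  the separation of f into a function of x and a power of H, are therefore obtained near u0.\<close>

lemma has_derivative_componentwise:
  fixes f :: "'a::real_normed_vector \<Rightarrow> complex ^ 'n"
  assumes "\<And>i. ((\<lambda>x. f x $ i) has_derivative (\<lambda>v. f' v $ i)) (at x)"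
  shows "(f has_derivative f') (at x)"
proof -
  have ax: "bounded_linear (axis i :: complex \<Rightarrow> complex ^ 'n)" for i
    by (rule linear_conv_bounded_linear[THEN iffD1]) (auto intro!: linearI simp: vec_eq_iff axis_def)
  have "((\<lambda>x. \<Sum>i\<in>UNIV. axis i (f x $ i)) has_derivative (\<lambda>v. \<Sum>i\<in>UNIV. axis i (f' v $ i))) (at x)"
    by (intro has_derivative_sum bounded_linear.has_derivative[OF ax] assms)
  moreover have "(\<Sum>i\<in>UNIV. axis i (z $ i)) = z" for z :: "complex ^ 'n"
    by (simp add: vec_eq_iff axis_def if_distrib sum.delta cong: if_cong)
  ultimately show ?thesis by simp
qed

lemma bounded_linear_coefficients:
  "bounded_linear (\<lambda>v :: complex ^ 'n. \<chi> i. \<Sum>k\<in>UNIV. a i k * v $ k)"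
proof -
  have "linear (\<lambda>v :: complex ^ 'n. \<chi> i. \<Sum>k\<in>UNIV. a i k * v $ k)"
    by (rule linearI) (simp_all add: vec_eq_iff distrib_left sum.distrib scaleR_sum_right)
  then show ?thesis by (rule linear_conv_bounded_linear[THEN iffD1])
qed

lemma cholomorphic_on_cong:
  assumes "open S" "\<And>u. u \<in> S \<Longrightarrow> f u = g u" "cholomorphic_on f S"
  shows "cholomorphic_on g S"
  unfolding cholomorphic_on_def
proof
  fix u assume u: "u \<in> S"
  then obtain D where D: "(f has_derivative D) (at u)" "\<forall>c v. D (c *s v) = c * D v"
    using assms(3) unfolding cholomorphic_on_def by blast
  have "(g has_derivative D) (at u)"
    by (rule has_derivative_transform_within_open[OF D(1) assms(1) u assms(2)])
  then show "\<exists>D. (g has_derivative D) (at u) \<and> (\<forall>c v. D (c *s v) = c * D v)"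
    using D(2) by blast
qed

text \<open>Used to pass from the flat coordinates of the frame to \<open>flat_coords\<close>: the
  two maps are shown to agree on a neighbourhood of \<open>u0\<close>, not as functions. The
  inverses agree everywhere, because \<open>the_inv_into\<close> inspects only values on
  \<open>W\<close>.\<close>

lemma biholomorphic_on_cong:
  assumes eq: "\<And>u. u \<in> W \<Longrightarrow> f u = g u" and f: "biholomorphic_on f W"
  shows "biholomorphic_on g W"
proof -
  have im: "g ` W = f ` W" using eq by auto
  have inv: "the_inv_into W g = the_inv_into W f"
    unfolding the_inv_into_def using eq by (intro ext arg_cong[where f = The]) auto
  have "inj_on g W" using f eq by (auto simp: biholomorphic_on_def inj_on_def)
  moreover have "cholomorphic_on (\<lambda>u. g u $ i) W" for i
    by (rule cholomorphic_on_cong[of W "\<lambda>u. f u $ i"]) (use f eq in \<open>auto simp: biholomorphic_on_def\<close>)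
  ultimately show ?thesis
    using f unfolding biholomorphic_on_def im inv by blast
qed


text \<open>\<open>has_derivative\<close> is a real notion, while \<open>pd\<close> is a complex
  derivative along an axis. A differential with complex coefficients restricts on the axis to
  multiplication by \<open>h \<alpha>\<close>, which is exactly a complex derivative.\<close>

lemma pd_eqI:
  fixes f :: "complex ^ 'n \<Rightarrow> complex"
  assumes "(f has_derivative (\<lambda>v. \<Sum>\<beta>\<in>UNIV. h \<beta> * v $ \<beta>)) (at p)"
  shows "pd \<alpha> f p = h \<alpha>"
proof -
  have "linear (axis \<alpha> :: complex \<Rightarrow> complex ^ 'n)"
    by (auto intro!: linearI simp: vec_eq_iff axis_def)
  then have ax: "(axis \<alpha> has_derivative (axis \<alpha> :: complex \<Rightarrow> complex ^ 'n)) (at 0)"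
    by (intro bounded_linear_imp_has_derivative linear_conv_bounded_linear[THEN iffD1])
  have "((\<lambda>z. p + axis \<alpha> z) has_derivative (\<lambda>z. 0 + axis \<alpha> z)) (at 0)"
    by (intro has_derivative_add has_derivative_const ax)
  moreover have "p + axis \<alpha> 0 = p" by (simp add: vec_eq_iff axis_def)
  then have "(f has_derivative (\<lambda>v. \<Sum>\<beta>\<in>UNIV. h \<beta> * v $ \<beta>)) (at (p + axis \<alpha> 0))"
    using assms by (simp only:)
  ultimately have "((\<lambda>z. f (p + axis \<alpha> z)) has_derivative (\<lambda>z. \<Sum>\<beta>\<in>UNIV. h \<beta> * (0 + axis \<alpha> z) $ \<beta>)) (at 0)"
    by (rule has_derivative_compose)
  moreover have "(\<lambda>z. \<Sum>\<beta>\<in>UNIV. h \<beta> * (0 + axis \<alpha> z) $ \<beta>) = (*) (h \<alpha>)"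
    by (rule ext) (simp add: axis_def if_distrib sum.delta cong: if_cong)
  ultimately have "((\<lambda>z. f (p + axis \<alpha> z)) has_field_derivative h \<alpha>) (at 0)"
    by (simp add: has_field_derivative_def)
  then show ?thesis unfolding pd_def by (rule DERIV_imp_deriv)
qed

text \<open>Serves iterated partial derivatives: the inner one is known by a formula only on an open
  set, and the outer one is computed from that formula.\<close>

lemma pd_eq_on_open:
  fixes f :: "complex ^ 'n \<Rightarrow> complex"
  assumes "open T" "p \<in> T" "\<And>q. q \<in> T \<Longrightarrow> g q = f q"
    and "(g has_derivative (\<lambda>v. \<Sum>\<beta>\<in>UNIV. h \<beta> * v $ \<beta>)) (at p)"
  shows "pd \<alpha> f p = h \<alpha>"
  by (rule pd_eqI, rule has_derivative_transform_within_open[OF assms(4,1,2,3)])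

section \<open>The antidiagonal metric and the degrees\<close>

lemma eta_entries [simp]:
  "eta $ 1 $ 1 = 0" "eta $ 1 $ 2 = 0" "eta $ 1 $ 3 = 1" "eta $ 2 $ 1 = 0" "eta $ 2 $ 2 = 1" "eta $ 2 $ 3 = 0"
  "eta $ 3 $ 1 = 1" "eta $ 3 $ 2 = 0" "eta $ 3 $ 3 = 0"
  by (simp_all add: eta_def)

lemma eta_eta: "eta ** eta = mat 1"
  by (simp add: vec_eq_iff forall_3 matrix_matrix_mult_def sum_3 mat_def)

lemma matrix_inv_eta: "matrix_inv eta = eta"
proof -
  have "eta ** matrix_inv eta = mat 1"
    unfolding matrix_inv_def by (rule someI2[of _ eta]) (simp_all add: eta_eta)
  then have "eta ** (eta ** matrix_inv eta) = eta" by simp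
  then show ?thesis by (simp add: matrix_mul_assoc eta_eta)
qed

text \<open>The map \<open>\<alpha> \<mapsto> 4 - \<alpha>\<close>, written out because the index type is cyclic; indices are raised and lowered by it.\<close>

definition dual_index :: "3 \<Rightarrow> 3" where
  "dual_index \<alpha> = (if \<alpha> = 1 then 3 else if \<alpha> = 3 then 1 else 2)"

lemma dual_index_simps [simp]: "dual_index 1 = 3" "dual_index 2 = 2" "dual_index 3 = 1"
  by (simp_all add: dual_index_def)

lemma eta_contract:
  "(\<Sum>\<kappa>\<in>UNIV. \<Sum>\<nu>\<in>UNIV. a \<kappa> * eta $ \<kappa> $ \<nu> * b \<nu>) = (\<Sum>\<kappa>\<in>UNIV. a \<kappa> * b (dual_index \<kappa>))"
  by (simp add: sum_3)

text \<open>These numbers are the degrees of the frame columns; the charges are q_\<alpha> =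
  \<open>weight \<mu> \<alpha> - \<mu>\<close>, so t^\<alpha> has degree
  \<open>1 + \<mu> - weight \<mu> \<alpha>\<close>.\<close>

definition weight :: "complex \<Rightarrow> 3 \<Rightarrow> complex" where
  "weight \<mu> \<alpha> = vector [\<mu>, 0, - \<mu>] $ \<alpha>"

lemma weight_simps [simp]: "weight \<mu> 1 = \<mu>" "weight \<mu> 2 = 0" "weight \<mu> 3 = - \<mu>"
  by (simp_all add: weight_def)

text \<open>Compares the double Euler sum with the closed formula; t1, p, r stand for S_13, S_12,
  S_11 and e for S_22 - S_13. The coefficient \<mu> + 4 comes from the monomial p r s23: it occurs
  once through the second gradient component, with 1/(2 + \<mu>), and once through the third, with
  1/2, and these add up to (\<mu> + 4) / (2 (2 + \<mu>)).\<close>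

lemma Euler_potential_identity:
  fixes \<mu> t1 p r s23 s33 e :: complex
  assumes nz: "1 + \<mu> \<noteq> 0" "1 + 2 * \<mu> \<noteq> 0" "1 - \<mu> \<noteq> 0" "1 - 2 * \<mu> \<noteq> 0" "2 + \<mu> \<noteq> 0" "3 + 2 * \<mu> \<noteq> 0"
  shows "(t1 * ((t1 * (r / (1 + 2 * \<mu>)) + p * (p / (1 + \<mu>)) + r * t1) / (2 + 2 * \<mu>))
      + p * ((t1 * (p / (1 + \<mu>)) + p * (t1 + e) + r * (s23 / (1 - \<mu>))) / (2 + \<mu>))
      + r * ((t1 * t1 + p * (s23 / (1 - \<mu>)) + r * (s33 / (1 - 2 * \<mu>))) / 2)) / (3 + 2 * \<mu>)
    = 1/2 * t1 * (p / (1 + \<mu>))\<^sup>2 + 1/2 * t1\<^sup>2 * (r / (1 + 2 * \<mu>))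
      + (r\<^sup>2 * s33 / (2 * (1 - 2 * \<mu>) * (3 + 2 * \<mu>))
        + (\<mu> + 4) * (p * r * s23) / (2 * (1 - \<mu>) * (2 + \<mu>) * (3 + 2 * \<mu>))
        + p\<^sup>2 * e / ((2 + \<mu>) * (3 + 2 * \<mu>)))" (is "?L / ?d = ?R")
proof -
  define P R s s' k where "P = p / (1 + \<mu>)" and "R = r / (1 + 2 * \<mu>)"
    and "s = s23 / (1 - \<mu>)" and "s' = s33 / (1 - 2 * \<mu>)" and "k = 1 / (2 + \<mu>)"
  note defs = this
  have p: "p = (1 + \<mu>) * P" and r: "r = (1 + 2 * \<mu>) * R" and k: "k * (2 + \<mu>) = 1"
    using nz by (simp_all add: defs)
  have g1: "(t1 * R + p * P + r * t1) / (2 + 2 * \<mu>) = t1 * R + P\<^sup>2 / 2"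
  proof -
    have "2 + 2 * \<mu> \<noteq> 0" using nz(1) by algebra
    then show ?thesis unfolding p r by (simp add: divide_simps power2_eq_square) algebra
  qed
  have g2: "(t1 * P + p * (t1 + e) + r * s) / (2 + \<mu>) = t1 * P + (p * e + r * s) * k"
  proof -
    have "t1 * P + p * (t1 + e) + r * s = t1 * P * (2 + \<mu>) + (p * e + r * s)"
      unfolding p by (simp add: algebra_simps)
    then show ?thesis using nz(5) by (simp add: k_def add_divide_distrib)
  qed
  have k2: "k + 1/2 = (\<mu> + 4) * k / 2"
  proof -
    have "(\<mu> + 4) * k = 1 + 2 * k" unfolding k[symmetric] by (simp add: algebra_simps)
    then show ?thesis by (simp add: add_divide_distrib)
  qed
  have "?L = t1 * (t1 * R + P\<^sup>2 / 2) + p * (t1 * P + (p * e + r * s) * k) + r * ((t1 * t1 + p * s + r * s') / 2)"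
    unfolding defs(1-4)[symmetric] g1 g2 ..
  also have "\<dots> = t1 * (t1 * R + P\<^sup>2 / 2) + p * t1 * P + r * t1 * t1 / 2 + p\<^sup>2 * e * k + p * r * s * (k + 1/2) + r\<^sup>2 * s' / 2"
    by (simp add: power2_eq_square algebra_simps add_divide_distrib)
  also have "\<dots> = (1/2 * t1 * P\<^sup>2 + 1/2 * t1\<^sup>2 * R) * (3 + 2 * \<mu>)
      + (r\<^sup>2 * s' / 2 + (\<mu> + 4) * (p * r * s) * k / 2 + p\<^sup>2 * e * k)"
  proof -
    \<comment> \<open>The terms containing t1 add up to 3 + 2\<mu> times the cubic part, so the
      final division leaves that part with its plain coefficients 1/2.\<close>
    have "t1 * (t1 * R + P\<^sup>2 / 2) + p * t1 * P + r * t1 * t1 / 2 = (1/2 * t1 * P\<^sup>2 + 1/2 * t1\<^sup>2 * R) * (3 + 2 * \<mu>)"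
      unfolding p r by (simp add: power2_eq_square field_simps)
    then show ?thesis unfolding k2 by simp
  qed
  finally have L: "?L = (1/2 * t1 * P\<^sup>2 + 1/2 * t1\<^sup>2 * R) * ?d
      + (r\<^sup>2 * s' / 2 + (\<mu> + 4) * (p * r * s) * k / 2 + p\<^sup>2 * e * k)" .
  have "(A * ?d + C) / ?d = A + C / ?d" for A C
    using nz(6) by (simp add: add_divide_distrib)
  then have "?L / ?d = 1/2 * t1 * P\<^sup>2 + 1/2 * t1\<^sup>2 * R
      + (r\<^sup>2 * s' / 2 + (\<mu> + 4) * (p * r * s) * k / 2 + p\<^sup>2 * e * k) / ?d"
    unfolding L .
  also have "\<dots> = ?R"
  proof -
    have "(r\<^sup>2 * s' / 2 + w * (p * r * s) * k / 2 + p\<^sup>2 * e * k) / ?d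
      = r\<^sup>2 * s33 / (2 * (1 - 2 * \<mu>) * ?d) + w * (p * r * s23) / (2 * (1 - \<mu>) * (2 + \<mu>) * ?d)
        + p\<^sup>2 * e / ((2 + \<mu>) * ?d)" for w
      unfolding defs by (simp add: add_divide_distrib mult_ac) (simp add: algebra_simps)
    then show ?thesis unfolding defs by simp
  qed
  finally show ?thesis .
qed

text \<open>The first column of \<Psi> holds the Lame coefficients of a diagonal flat metric in the
  canonical coordinates u_j, and \<Gamma> its rotation coefficients; their symmetry is the Egoroff
  property. \<open>frame_euler\<close> is the differential of \<open>frame_deriv\<close> evaluated
  on the Euler field u, so it states that column \<alpha> is homogeneous of degree
  \<open>weight \<mu> \<alpha>\<close>.\<close>

locale egoroff_frame =
  fixes U :: "(complex ^ 3) set" and \<Psi> \<Gamma> :: "complex ^ 3 \<Rightarrow> complex ^ 3 ^ 3" and \<mu> :: complex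
  assumes open_U: "open U"
    and rotation_sym: "u \<in> U \<Longrightarrow> \<Gamma> u $ j $ k = \<Gamma> u $ k $ j"
    and frame_deriv: "u \<in> U \<Longrightarrow> ((\<lambda>u. \<Psi> u $ j $ \<alpha>) has_derivative
          (\<lambda>v. \<Sum>k\<in>UNIV. \<Gamma> u $ j $ k * \<Psi> u $ k $ \<alpha> * (v $ k - v $ j))) (at u)"
    and frame_euler: "u \<in> U \<Longrightarrow>
          (\<Sum>k\<in>UNIV. \<Gamma> u $ j $ k * \<Psi> u $ k $ \<alpha> * (u $ k - u $ j)) = weight \<mu> \<alpha> * \<Psi> u $ j $ \<alpha>"
    and frame_orth: "u \<in> U \<Longrightarrow> (\<Sum>j\<in>UNIV. \<Psi> u $ j $ \<alpha> * \<Psi> u $ j $ \<beta>) = eta $ \<alpha> $ \<beta>"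
    and frame_nonzero: "u \<in> U \<Longrightarrow> \<Psi> u $ j $ 1 \<noteq> 0"
    and nonresonant: "\<mu> \<notin> {1/2, -1/2, 1, -1, 3/2, -3/2, 2, -2, 3, -3}"
begin

text \<open>\<open>H\<close> is the Hessian of the potential in flat coordinates; \<open>G\<close> (its gradient) and \<open>F\<close> are obtained
  by Euler's identity: \<open>S 1 (dual_index \<beta>)\<close> is \<open>1 - q\<^sub>\<beta>\<close> times the flat coordinate \<open>t\<^sup>\<beta>\<close>.\<close>

definition S :: "3 \<Rightarrow> 3 \<Rightarrow> complex ^ 3 \<Rightarrow> complex" where
  "S \<alpha> \<beta> u = (\<Sum>j\<in>UNIV. u $ j * (\<Psi> u $ j $ \<alpha> * \<Psi> u $ j $ \<beta>))"

definition H :: "3 \<Rightarrow> 3 \<Rightarrow> complex ^ 3 \<Rightarrow> complex" where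
  "H \<alpha> \<beta> u = S \<alpha> \<beta> u / (1 + weight \<mu> \<alpha> + weight \<mu> \<beta>)"

definition t :: "complex ^ 3 \<Rightarrow> complex ^ 3" where
  "t u = (\<chi> \<beta>. H 1 (dual_index \<beta>) u)"

definition G :: "3 \<Rightarrow> complex ^ 3 \<Rightarrow> complex" where
  "G \<alpha> u = (\<Sum>\<beta>\<in>UNIV. S 1 (dual_index \<beta>) u * H \<alpha> \<beta> u) / (2 + \<mu> + weight \<mu> \<alpha>)"

definition F :: "complex ^ 3 \<Rightarrow> complex" where
  "F u = (\<Sum>\<alpha>\<in>UNIV. S 1 (dual_index \<alpha>) u * G \<alpha> u) / (3 + 2 * \<mu>)"

definition dt :: "complex ^ 3 \<Rightarrow> complex ^ 3 \<Rightarrow> complex ^ 3" where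
  "dt u v = (\<chi> \<beta>. \<Sum>i\<in>UNIV. \<Psi> u $ i $ 1 * \<Psi> u $ i $ (dual_index \<beta>) * v $ i)"

text \<open>The inverse Jacobian of \<open>t\<close>. It can be written down explicitly because the
  rows of the frame are dual to each other; the division by the first column is where its
  nonvanishing enters.\<close>

definition du :: "complex ^ 3 \<Rightarrow> complex ^ 3 \<Rightarrow> complex ^ 3" where
  "du u w = (\<chi> i. \<Sum>\<beta>\<in>UNIV. \<Psi> u $ i $ \<beta> / \<Psi> u $ i $ 1 * w $ \<beta>)"

definition correlator :: "3 \<Rightarrow> 3 \<Rightarrow> 3 \<Rightarrow> complex ^ 3 \<Rightarrow> complex" where
  "correlator \<alpha> \<beta> \<gamma> u = (\<Sum>i\<in>UNIV. \<Psi> u $ i $ \<alpha> * \<Psi> u $ i $ \<beta> * \<Psi> u $ i $ \<gamma> / \<Psi> u $ i $ 1)"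

section \<open>Homogeneity and the derivatives of the potential\<close>

lemma resonance_factors_nonzero:
  "1 + \<mu> \<noteq> 0" "1 + 2 * \<mu> \<noteq> 0" "1 - \<mu> \<noteq> 0" "1 - 2 * \<mu> \<noteq> 0" "2 + \<mu> \<noteq> 0" "3 + 2 * \<mu> \<noteq> 0"
proof -
  \<comment> \<open>Each factor is affine in \<mu>, and its root -b/a lies in the excluded
    set.\<close>
  have *: "b + a * \<mu> \<noteq> 0" if "a \<noteq> 0" "- b / a \<in> {1/2, -1/2, 1, -1, 3/2, -3/2, 2, -2, 3, -3}" for a b
  proof
    assume "b + a * \<mu> = 0"
    then have "\<mu> = - b / a" using that(1) by (simp add: field_simps eq_neg_iff_add_eq_0)
    then show False using that(2) nonresonant by simp
  qed
  show "1 + \<mu> \<noteq> 0" "1 + 2 * \<mu> \<noteq> 0" "1 - \<mu> \<noteq> 0" "1 - 2 * \<mu> \<noteq> 0" "2 + \<mu> \<noteq> 0" "3 + 2 * \<mu> \<noteq> 0"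
    using *[of 1 1] *[of 2 1] *[of "-1" 1] *[of "-2" 1] *[of 1 2] *[of 2 3] by simp_all
qed

text \<open>The first number is the degree of a second derivative of the potential, the second that
  of a first derivative, namely 3 + 2\<mu> minus the degree of t^\<alpha>.\<close>

lemma degree_nonzero: "1 + weight \<mu> \<alpha> + weight \<mu> \<beta> \<noteq> 0" "2 + \<mu> + weight \<mu> \<alpha> \<noteq> 0"
proof -
  have a: "1 + \<mu> + \<mu> \<noteq> 0" "1 - \<mu> - \<mu> \<noteq> 0" "2 + \<mu> + \<mu> \<noteq> 0"
    using resonance_factors_nonzero(1,2,4) by (simp_all add: algebra_simps) algebra
  show "1 + weight \<mu> \<alpha> + weight \<mu> \<beta> \<noteq> 0"
    using exhaust_3[of \<alpha>] exhaust_3[of \<beta>] a resonance_factors_nonzero by (elim disjE) simp_all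
  show "2 + \<mu> + weight \<mu> \<alpha> \<noteq> 0"
    using exhaust_3[of \<alpha>] a resonance_factors_nonzero by (elim disjE) simp_all
qed

lemma weight_dual: "weight \<mu> (dual_index \<beta>) = - weight \<mu> \<beta>"
  using exhaust_3[of \<beta>] by (elim disjE) simp_all

lemma S_sym: "S \<alpha> \<beta> u = S \<beta> \<alpha> u"
  by (simp add: S_def mult.commute)

lemma H_sym: "H \<alpha> \<beta> u = H \<beta> \<alpha> u"
  by (simp add: H_def S_sym add_ac)

lemma S_eq_H: "S \<alpha> \<beta> u = (1 + weight \<mu> \<alpha> + weight \<mu> \<beta>) * H \<alpha> \<beta> u"
  using degree_nonzero by (simp add: H_def)

text \<open>Orthogonality of the columns gives a left inverse of \<Psi>. A left inverse of a square
  matrix is also a right inverse, and this is orthogonality of the rows.\<close>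

lemma frame_completeness:
  assumes "u \<in> U"
  shows "(\<Sum>\<beta>\<in>UNIV. \<Psi> u $ j $ \<beta> * \<Psi> u $ k $ (dual_index \<beta>)) = (if j = k then 1 else 0)"
proof -
  let ?L = "eta ** transpose (\<Psi> u)"
  have "?L ** \<Psi> u = eta ** (transpose (\<Psi> u) ** \<Psi> u)"
    by (simp add: matrix_mul_assoc)
  also have "transpose (\<Psi> u) ** \<Psi> u = eta"
    using frame_orth[OF assms] by (simp add: vec_eq_iff matrix_matrix_mult_def transpose_def)
  finally have "?L ** \<Psi> u = mat 1" by (simp add: eta_eta)
  then have "\<Psi> u ** ?L = mat 1" using matrix_left_right_inverse by blast
  then have "(\<Psi> u ** ?L) $ j $ k = mat 1 $ j $ k" by simp
  then show ?thesis
    by (simp add: matrix_matrix_mult_def transpose_def sum_3 mat_def)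
qed

text \<open>The derivative of the frame contributes a sum of u_j (v_k - v_j) against coefficients
  symmetric in j and k. Symmetrising the sum shows that u and v may be exchanged; then v_j stands
  outside and \<open>frame_euler\<close> evaluates the inner sum, which yields the two
  weights.\<close>

lemma S_deriv:
  assumes "u \<in> U"
  shows "(S \<alpha> \<beta> has_derivative (\<lambda>v. (1 + weight \<mu> \<alpha> + weight \<mu> \<beta>) * (\<Sum>i\<in>UNIV. \<Psi> u $ i $ \<alpha> * \<Psi> u $ i $ \<beta> * v $ i))) (at u)"
proof -
  let ?D = "\<lambda>j \<alpha> v. \<Sum>k\<in>UNIV. \<Gamma> u $ j $ k * \<Psi> u $ k $ \<alpha> * (v $ k - v $ j)"
  have nth: "((\<lambda>u. u $ j) has_derivative (\<lambda>v. v $ j)) (at u)" for j :: 3 and u :: "complex ^ 3"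
    by (rule bounded_linear_imp_has_derivative[OF bounded_linear_vec_nth])
  have "(S \<alpha> \<beta> has_derivative (\<lambda>v. \<Sum>j\<in>UNIV. u $ j * (\<Psi> u $ j $ \<alpha> * ?D j \<beta> v + ?D j \<alpha> v * \<Psi> u $ j $ \<beta>)
       + v $ j * (\<Psi> u $ j $ \<alpha> * \<Psi> u $ j $ \<beta>))) (at u)"
    unfolding S_def[abs_def]
    by (intro has_derivative_sum has_derivative_mult frame_deriv[OF assms] nth)
  moreover have "(\<Sum>j\<in>UNIV. u $ j * (\<Psi> u $ j $ \<alpha> * ?D j \<beta> v + ?D j \<alpha> v * \<Psi> u $ j $ \<beta>)
       + v $ j * (\<Psi> u $ j $ \<alpha> * \<Psi> u $ j $ \<beta>))
    = (1 + weight \<mu> \<alpha> + weight \<mu> \<beta>) * (\<Sum>i\<in>UNIV. \<Psi> u $ i $ \<alpha> * \<Psi> u $ i $ \<beta> * v $ i)" for v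
  proof -
    have "(1 + weight \<mu> \<alpha> + weight \<mu> \<beta>) * (\<Sum>i\<in>UNIV. \<Psi> u $ i $ \<alpha> * \<Psi> u $ i $ \<beta> * v $ i)
      = (\<Sum>i\<in>UNIV. v $ i * (\<Psi> u $ i $ \<alpha> * \<Psi> u $ i $ \<beta>) + (weight \<mu> \<alpha> * \<Psi> u $ i $ \<alpha>) * (\<Psi> u $ i $ \<beta> * v $ i)
           + (weight \<mu> \<beta> * \<Psi> u $ i $ \<beta>) * (\<Psi> u $ i $ \<alpha> * v $ i))"
      by (simp add: sum_3 algebra_simps)
    also have "\<dots> = (\<Sum>j\<in>UNIV. u $ j * (\<Psi> u $ j $ \<alpha> * ?D j \<beta> v + ?D j \<alpha> v * \<Psi> u $ j $ \<beta>)
       + v $ j * (\<Psi> u $ j $ \<alpha> * \<Psi> u $ j $ \<beta>))"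
      unfolding frame_euler[OF assms, symmetric]
      using rotation_sym[OF assms, of 2 1] rotation_sym[OF assms, of 3 1] rotation_sym[OF assms, of 3 2]
      by (simp add: sum_3) (simp add: algebra_simps)
    finally show ?thesis ..
  qed
  ultimately show ?thesis by simp
qed

lemma H_deriv:
  assumes "u \<in> U"
  shows "(H \<alpha> \<beta> has_derivative (\<lambda>v. \<Sum>i\<in>UNIV. \<Psi> u $ i $ \<alpha> * \<Psi> u $ i $ \<beta> * v $ i)) (at u)"
proof -
  have "((\<lambda>u. S \<alpha> \<beta> u * inverse (1 + weight \<mu> \<alpha> + weight \<mu> \<beta>)) has_derivative
     (\<lambda>v. ((1 + weight \<mu> \<alpha> + weight \<mu> \<beta>) * (\<Sum>i\<in>UNIV. \<Psi> u $ i $ \<alpha> * \<Psi> u $ i $ \<beta> * v $ i))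
        * inverse (1 + weight \<mu> \<alpha> + weight \<mu> \<beta>))) (at u)"
    by (rule has_derivative_mult_left[OF S_deriv[OF assms]])
  then show ?thesis
    unfolding H_def[abs_def] divide_inverse
    by (rule has_derivative_eq_rhs) (use degree_nonzero(1)[of \<alpha> \<beta>] in \<open>simp add: mult_ac fun_eq_iff\<close>)
qed

lemma t_deriv:
  assumes "u \<in> U"
  shows "(t has_derivative dt u) (at u)"
  unfolding t_def[abs_def] dt_def[abs_def]
  by (rule has_derivative_componentwise) (simp add: H_deriv[OF assms])

lemma du_dt:
  assumes "u \<in> U"
  shows "du u (dt u v) = v"
proof -
  have "du u (dt u v) $ i = v $ i" for i
  proof -
    have "du u (dt u v) $ i = (\<Sum>j\<in>UNIV. (\<Sum>\<beta>\<in>UNIV. \<Psi> u $ i $ \<beta> * \<Psi> u $ j $ (dual_index \<beta>)) * \<Psi> u $ j $ 1 * v $ j) / \<Psi> u $ i $ 1"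
      by (simp add: du_def dt_def sum_3 add_divide_distrib algebra_simps)
    also have "\<dots> = v $ i"
      unfolding frame_completeness[OF assms] using frame_nonzero[OF assms, of i]
      by (simp add: if_distrib[of "\<lambda>z. z * _"] cong: if_cong)
    finally show ?thesis .
  qed
  then show ?thesis by (simp add: vec_eq_iff)
qed

text \<open>Rewrites the differential of the Hessian in flat coordinates: the denominators in the
  correlators assemble to \<open>du\<close>, which undoes \<open>dt\<close>.\<close>

lemma correlator_flat:
  assumes "u \<in> U"
  shows "(\<Sum>\<gamma>\<in>UNIV. correlator \<alpha> \<beta> \<gamma> u * dt u v $ \<gamma>) = (\<Sum>i\<in>UNIV. \<Psi> u $ i $ \<alpha> * \<Psi> u $ i $ \<beta> * v $ i)"
proof -
  have "(\<Sum>\<gamma>\<in>UNIV. correlator \<alpha> \<beta> \<gamma> u * dt u v $ \<gamma>) = (\<Sum>i\<in>UNIV. \<Psi> u $ i $ \<alpha> * \<Psi> u $ i $ \<beta> * du u (dt u v) $ i)"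
    unfolding correlator_def du_def by (simp add: sum_3 algebra_simps)
  then show ?thesis by (simp add: du_dt[OF assms])
qed

text \<open>The numbers \<open>S 1 (dual_index \<beta>) u\<close> are the flat components of the
  Euler field. In view of the symmetry of third derivatives, the agreement of the two sums is
  Euler's identity for the Hessian, in a form that involves no third derivatives.\<close>

lemma S_contract:
  assumes "u \<in> U"
  shows "(\<Sum>\<beta>\<in>UNIV. S \<alpha> \<beta> u * dt u v $ \<beta>) = (\<Sum>i\<in>UNIV. u $ i * \<Psi> u $ i $ \<alpha> * \<Psi> u $ i $ 1 * v $ i)" (is ?A)
    and "(\<Sum>\<beta>\<in>UNIV. S 1 (dual_index \<beta>) u * (\<Sum>i\<in>UNIV. \<Psi> u $ i $ \<alpha> * \<Psi> u $ i $ \<beta> * v $ i))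
      = (\<Sum>i\<in>UNIV. u $ i * \<Psi> u $ i $ \<alpha> * \<Psi> u $ i $ 1 * v $ i)" (is ?B)
proof -
  have "(\<Sum>\<beta>\<in>UNIV. S \<alpha> \<beta> u * dt u v $ \<beta>) = (\<Sum>j\<in>UNIV. \<Sum>i\<in>UNIV. u $ j * \<Psi> u $ j $ \<alpha> * \<Psi> u $ i $ 1 * v $ i *
       (\<Sum>\<beta>\<in>UNIV. \<Psi> u $ j $ \<beta> * \<Psi> u $ i $ (dual_index \<beta>)))"
    by (simp add: S_def dt_def sum_3 algebra_simps)
  also have "\<dots> = (\<Sum>i\<in>UNIV. u $ i * \<Psi> u $ i $ \<alpha> * \<Psi> u $ i $ 1 * v $ i)"
    unfolding frame_completeness[OF assms] by (simp add: if_distrib cong: if_cong)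
  finally show ?A .
  have "(\<Sum>\<beta>\<in>UNIV. S 1 (dual_index \<beta>) u * (\<Sum>i\<in>UNIV. \<Psi> u $ i $ \<alpha> * \<Psi> u $ i $ \<beta> * v $ i))
     = (\<Sum>i\<in>UNIV. \<Sum>j\<in>UNIV. u $ j * \<Psi> u $ i $ \<alpha> * \<Psi> u $ j $ 1 * v $ i *
       (\<Sum>\<beta>\<in>UNIV. \<Psi> u $ i $ \<beta> * \<Psi> u $ j $ (dual_index \<beta>)))"
    by (simp add: S_def sum_3 algebra_simps)
  also have "\<dots> = (\<Sum>i\<in>UNIV. u $ i * \<Psi> u $ i $ \<alpha> * \<Psi> u $ i $ 1 * v $ i)"
    unfolding frame_completeness[OF assms] by (simp add: if_distrib cong: if_cong)
  finally show ?B .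
qed

lemma S1_deriv:
  assumes "u \<in> U"
  shows "(S 1 (dual_index \<beta>) has_derivative (\<lambda>v. (1 + \<mu> - weight \<mu> \<beta>) * dt u v $ \<beta>)) (at u)"
  using S_deriv[OF assms, of 1 "dual_index \<beta>"] by (simp add: weight_dual dt_def)

text \<open>The product rule yields H_\<alpha>\<beta> dt^\<beta> twice: with factor 1 + m_\<alpha> +
  m_\<beta> from the Hessian and 1 + \<mu> - m_\<beta> from the Euler field. In the sum \<beta>
  drops out, so a single division by 2 + \<mu> + m_\<alpha> is enough.\<close>

lemma G_deriv:
  assumes "u \<in> U"
  shows "(G \<alpha> has_derivative (\<lambda>v. \<Sum>\<beta>\<in>UNIV. H \<alpha> \<beta> u * dt u v $ \<beta>)) (at u)"
proof -
  let ?d = "2 + \<mu> + weight \<mu> \<alpha>"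
  have "((\<lambda>u. (\<Sum>\<beta>\<in>UNIV. S 1 (dual_index \<beta>) u * H \<alpha> \<beta> u) * inverse ?d) has_derivative
     (\<lambda>v. (\<Sum>\<beta>\<in>UNIV. S 1 (dual_index \<beta>) u * (\<Sum>i\<in>UNIV. \<Psi> u $ i $ \<alpha> * \<Psi> u $ i $ \<beta> * v $ i)
        + (1 + \<mu> - weight \<mu> \<beta>) * dt u v $ \<beta> * H \<alpha> \<beta> u) * inverse ?d)) (at u)"
    by (intro has_derivative_mult_left has_derivative_sum has_derivative_mult S1_deriv[OF assms] H_deriv[OF assms])
  moreover have "(\<Sum>\<beta>\<in>UNIV. S 1 (dual_index \<beta>) u * (\<Sum>i\<in>UNIV. \<Psi> u $ i $ \<alpha> * \<Psi> u $ i $ \<beta> * v $ i)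
        + (1 + \<mu> - weight \<mu> \<beta>) * dt u v $ \<beta> * H \<alpha> \<beta> u) * inverse ?d = (\<Sum>\<beta>\<in>UNIV. H \<alpha> \<beta> u * dt u v $ \<beta>)" for v
  proof -
    have "(\<Sum>\<beta>\<in>UNIV. S 1 (dual_index \<beta>) u * (\<Sum>i\<in>UNIV. \<Psi> u $ i $ \<alpha> * \<Psi> u $ i $ \<beta> * v $ i)
        + (1 + \<mu> - weight \<mu> \<beta>) * dt u v $ \<beta> * H \<alpha> \<beta> u)
      = (\<Sum>\<beta>\<in>UNIV. S \<alpha> \<beta> u * dt u v $ \<beta> + (1 + \<mu> - weight \<mu> \<beta>) * dt u v $ \<beta> * H \<alpha> \<beta> u)"
      unfolding sum.distrib S_contract[OF assms] ..
    also have "\<dots> = ?d * (\<Sum>\<beta>\<in>UNIV. H \<alpha> \<beta> u * dt u v $ \<beta>)"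
      unfolding S_eq_H by (simp add: sum_3 algebra_simps)
    finally show ?thesis using degree_nonzero(2)[of \<alpha>] by simp
  qed
  ultimately show ?thesis unfolding G_def[abs_def] by (simp add: divide_inverse)
qed

text \<open>The same mechanism one order lower, now with the symmetry of the Hessian: (2 + \<mu> +
  m_\<alpha>) + (1 + \<mu> - m_\<alpha>) = 3 + 2\<mu> for every \<alpha>.\<close>

lemma F_deriv:
  assumes "u \<in> U"
  shows "(F has_derivative (\<lambda>v. \<Sum>\<beta>\<in>UNIV. G \<beta> u * dt u v $ \<beta>)) (at u)"
proof -
  let ?d = "3 + 2 * \<mu>"
  have "((\<lambda>u. (\<Sum>\<alpha>\<in>UNIV. S 1 (dual_index \<alpha>) u * G \<alpha> u) * inverse ?d) has_derivative
     (\<lambda>v. (\<Sum>\<alpha>\<in>UNIV. S 1 (dual_index \<alpha>) u * (\<Sum>\<beta>\<in>UNIV. H \<alpha> \<beta> u * dt u v $ \<beta>)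
        + (1 + \<mu> - weight \<mu> \<alpha>) * dt u v $ \<alpha> * G \<alpha> u) * inverse ?d)) (at u)"
    by (intro has_derivative_mult_left has_derivative_sum has_derivative_mult S1_deriv[OF assms] G_deriv[OF assms])
  moreover have "(\<Sum>\<alpha>\<in>UNIV. S 1 (dual_index \<alpha>) u * (\<Sum>\<beta>\<in>UNIV. H \<alpha> \<beta> u * dt u v $ \<beta>)
        + (1 + \<mu> - weight \<mu> \<alpha>) * dt u v $ \<alpha> * G \<alpha> u) * inverse ?d = (\<Sum>\<beta>\<in>UNIV. G \<beta> u * dt u v $ \<beta>)" for v
  proof -
    have "(\<Sum>\<alpha>\<in>UNIV. S 1 (dual_index \<alpha>) u * (\<Sum>\<beta>\<in>UNIV. H \<alpha> \<beta> u * dt u v $ \<beta>))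
      = (\<Sum>\<beta>\<in>UNIV. (\<Sum>\<alpha>\<in>UNIV. S 1 (dual_index \<alpha>) u * H \<beta> \<alpha> u) * dt u v $ \<beta>)"
      unfolding H_sym[of _ _ u] by (simp add: sum_3 algebra_simps H_sym[of 2 1] H_sym[of 3 1] H_sym[of 3 2])
    also have "\<dots> = (\<Sum>\<beta>\<in>UNIV. (2 + \<mu> + weight \<mu> \<beta>) * G \<beta> u * dt u v $ \<beta>)"
      using degree_nonzero(2) by (simp add: G_def)
    finally have "(\<Sum>\<alpha>\<in>UNIV. S 1 (dual_index \<alpha>) u * (\<Sum>\<beta>\<in>UNIV. H \<alpha> \<beta> u * dt u v $ \<beta>)
        + (1 + \<mu> - weight \<mu> \<alpha>) * dt u v $ \<alpha> * G \<alpha> u) = ?d * (\<Sum>\<beta>\<in>UNIV. G \<beta> u * dt u v $ \<beta>)"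
      unfolding sum.distrib by (simp add: sum_3 algebra_simps)
    then show ?thesis using resonance_factors_nonzero(6) by simp
  qed
  ultimately show ?thesis unfolding F_def[abs_def] by (simp add: divide_inverse)
qed

lemma F_eq:
  "F u = 1/2 * t u $ 1 * (t u $ 2)\<^sup>2 + 1/2 * (t u $ 1)\<^sup>2 * t u $ 3
      + ((S 1 1 u)\<^sup>2 * S 3 3 u / (2 * (1 - 2 * \<mu>) * (3 + 2 * \<mu>))
        + (\<mu> + 4) * (S 1 2 u * S 1 1 u * S 2 3 u) / (2 * (1 - \<mu>) * (2 + \<mu>) * (3 + 2 * \<mu>))
        + (S 1 2 u)\<^sup>2 * (S 2 2 u - S 1 3 u) / ((2 + \<mu>) * (3 + 2 * \<mu>)))"
proof -
  have t: "t u $ 1 = S 1 3 u" "t u $ 2 = S 1 2 u / (1 + \<mu>)" "t u $ 3 = S 1 1 u / (1 + 2 * \<mu>)"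
    by (simp_all add: t_def H_def algebra_simps)
  \<comment> \<open>\<open>S 2 2\<close> is split into \<open>S 1 3\<close> and a difference, since
    both will contain the summand u_1 and only the difference is free of it; this is the source of
    b2 - a in the formula.\<close>
  have H: "H 1 1 u = S 1 1 u / (1 + 2 * \<mu>)" "H 1 2 u = S 1 2 u / (1 + \<mu>)" "H 1 3 u = S 1 3 u"
    "H 2 1 u = S 1 2 u / (1 + \<mu>)" "H 2 2 u = S 1 3 u + (S 2 2 u - S 1 3 u)" "H 2 3 u = S 2 3 u / (1 - \<mu>)"
    "H 3 1 u = S 1 3 u" "H 3 2 u = S 2 3 u / (1 - \<mu>)" "H 3 3 u = S 3 3 u / (1 - 2 * \<mu>)"
    by (simp_all add: H_def S_sym[of 2 1] S_sym[of 3 1] S_sym[of 3 2] algebra_simps)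
  have F: "F u = (S 1 3 u * ((S 1 3 u * H 1 1 u + S 1 2 u * H 1 2 u + S 1 1 u * H 1 3 u) / (2 + 2 * \<mu>))
      + S 1 2 u * ((S 1 3 u * H 2 1 u + S 1 2 u * H 2 2 u + S 1 1 u * H 2 3 u) / (2 + \<mu>))
      + S 1 1 u * ((S 1 3 u * H 3 1 u + S 1 2 u * H 3 2 u + S 1 1 u * H 3 3 u) / 2)) / (3 + 2 * \<mu>)"
    by (simp add: F_def G_def sum_3 add.assoc)
  show ?thesis
    unfolding F H t by (rule Euler_potential_identity[OF resonance_factors_nonzero])
qed

text \<open>Completeness of the rows makes the product diagonal in canonical coordinates. What
  remains is a single sum, symmetric in all four indices.\<close>

lemma correlator_contract:
  assumes "u \<in> U"
  shows "(\<Sum>\<kappa>\<in>UNIV. \<Sum>\<nu>\<in>UNIV. correlator \<alpha> \<beta> \<kappa> u * eta $ \<kappa> $ \<nu> * correlator \<nu> \<gamma> \<delta> u)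
     = (\<Sum>i\<in>UNIV. \<Psi> u $ i $ \<alpha> * \<Psi> u $ i $ \<beta> * \<Psi> u $ i $ \<gamma> * \<Psi> u $ i $ \<delta> / (\<Psi> u $ i $ 1)\<^sup>2)"
proof -
  define p where "p i = \<Psi> u $ i $ \<alpha> * \<Psi> u $ i $ \<beta> / \<Psi> u $ i $ 1" for i
  define q where "q i = \<Psi> u $ i $ \<gamma> * \<Psi> u $ i $ \<delta> / \<Psi> u $ i $ 1" for i
  have "correlator \<alpha> \<beta> \<kappa> u = (\<Sum>i\<in>UNIV. p i * \<Psi> u $ i $ \<kappa>)" "correlator \<kappa> \<gamma> \<delta> u = (\<Sum>i\<in>UNIV. q i * \<Psi> u $ i $ \<kappa>)" for \<kappa>
    by (simp_all add: correlator_def p_def q_def mult_ac)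
  then have "(\<Sum>\<kappa>\<in>UNIV. \<Sum>\<nu>\<in>UNIV. correlator \<alpha> \<beta> \<kappa> u * eta $ \<kappa> $ \<nu> * correlator \<nu> \<gamma> \<delta> u)
      = (\<Sum>\<kappa>\<in>UNIV. (\<Sum>i\<in>UNIV. p i * \<Psi> u $ i $ \<kappa>) * (\<Sum>i\<in>UNIV. q i * \<Psi> u $ i $ (dual_index \<kappa>)))"
    by (simp only: eta_contract)
  also have "\<dots> = (\<Sum>i\<in>UNIV. \<Sum>j\<in>UNIV. p i * q j * (\<Sum>\<kappa>\<in>UNIV. \<Psi> u $ i $ \<kappa> * \<Psi> u $ j $ (dual_index \<kappa>)))"
    by (simp add: sum_3 algebra_simps)
  also have "\<dots> = (\<Sum>i\<in>UNIV. p i * q i)"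
    unfolding frame_completeness[OF assms] by (simp add: if_distrib cong: if_cong)
  finally show ?thesis by (simp add: p_def q_def power2_eq_square mult_ac)
qed

section \<open>Local inversion and descent to flat coordinates\<close>

lemma du_scale: "du u (z *s w) = z *s du u w"
  by (simp add: du_def vec_eq_iff sum_distrib_left mult_ac)

lemma du_linear: "bounded_linear (du u)"
  unfolding du_def[abs_def] by (rule bounded_linear_coefficients)

lemma dt_linear: "bounded_linear (dt u)"
  unfolding dt_def[abs_def] by (rule bounded_linear_coefficients)

lemma continuous_frame: "continuous_on U (\<lambda>u. \<Psi> u $ j $ \<alpha>)"
  by (rule has_derivative_continuous_on[OF has_derivative_at_withinI[OF frame_deriv]])

text \<open>The inverse function theorem is applied over the reals. Identifying the derivative of
  the inverse with \<open>du\<close>, which is complex linear, is what later makes the inverse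
  holomorphic.\<close>

lemma local_inverse:
  assumes "u0 \<in> U"
  obtains W where "open W" "u0 \<in> W" "W \<subseteq> U" "open (t ` W)" "inj_on t W"
    "\<And>u. u \<in> W \<Longrightarrow> (the_inv_into W t has_derivative du u) (at (t u))"
proof -
  let ?f' = "\<lambda>u. Blinfun (dt u)"
  have app: "blinfun_apply (?f' u) = dt u" for u
    by (rule bounded_linear_Blinfun_apply[OF dt_linear])
  have cont: "continuous_on U ?f'"
  proof (rule continuous_on_blinfun_componentwise)
    fix b :: "complex ^ 3"
    show "continuous_on U (\<lambda>u. blinfun_apply (?f' u) b)"
      unfolding app dt_def by (intro continuous_intros continuous_frame)
  qed
  have left_inv: "Blinfun (du u0) o\<^sub>L ?f' u0 = id_blinfun"
    by (rule blinfun_eqI) (simp add: app bounded_linear_Blinfun_apply[OF du_linear] du_dt[OF assms])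
  obtain W V g g' where W: "open W" "W \<subseteq> U" "u0 \<in> W" "open V" and hom: "homeomorphism W V t g"
    and g: "\<And>p. p \<in> V \<Longrightarrow> (g has_derivative g' p) (at p)"
      "\<And>p. p \<in> V \<Longrightarrow> g' p = inv (blinfun_apply (?f' (g p)))"
      "\<And>p. p \<in> V \<Longrightarrow> bij (blinfun_apply (?f' (g p)))"
    using inverse_function_theorem[of U t ?f' u0, OF open_U _ cont assms left_inv] t_deriv unfolding app by metis
  have V: "V = t ` W" using hom by (simp add: homeomorphism_def)
  have inj: "inj_on t W" using hom by (metis homeomorphism_def inj_on_inverseI)
  have gt: "g (t u) = u" if "u \<in> W" for u using hom that by (simp add: homeomorphism_def)
  have "(the_inv_into W t has_derivative du u) (at (t u))" if u: "u \<in> W" for u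
  proof -
    have "t u \<in> V" using u V by simp
    note d = g(1)[OF this] and d' = g(2)[OF this] and bij = g(3)[OF this]
    \<comment> \<open>The theorem delivers some inverse of the bijection \<open>dt u\<close>; the
      explicit left inverse \<open>du u\<close> has to coincide with it.\<close>
    have "g' (t u) w = du u w" for w
    proof -
      have "dt u (g' (t u) w) = w"
        using bij_is_surj[OF bij] unfolding d' app gt[OF u] by (simp add: surj_f_inv_f)
      then show ?thesis using du_dt[of u "g' (t u) w"] u W(2) by auto
    qed
    then have "(g has_derivative du u) (at (t u))" using d by (metis ext)
    moreover have "the_inv_into W t p = g p" if "p \<in> V" for p
      using that inj unfolding V by (auto simp: gt the_inv_into_f_f)
    ultimately show ?thesis
      using has_derivative_transform_within_open[OF _ W(4) \<open>t u \<in> V\<close>] by metis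
  qed
  then show ?thesis using that W V inj by metis
qed

theorem WDVV_solution_locally:
  assumes "u0 \<in> U"
  obtains W Fh where "open W" "u0 \<in> W" "W \<subseteq> U" "biholomorphic_on t W"
    "\<And>u. u \<in> W \<Longrightarrow> Fh (t u) = F u"
    "WDVV_solution (- 2 * \<mu>) (vector [0, - \<mu>, - 2 * \<mu>]) (t ` W) Fh"
proof -
  obtain W where W: "open W" "u0 \<in> W" "W \<subseteq> U" "open (t ` W)" "inj_on t W"
    and inv: "\<And>u. u \<in> W \<Longrightarrow> (the_inv_into W t has_derivative du u) (at (t u))"
    using local_inverse[OF assms] by blast
  let ?s = "the_inv_into W t"
  have st: "?s (t u) = u" if "u \<in> W" for u using W(5) that by (rule the_inv_into_f_f)
  \<comment> \<open>An injective linear endomorphism in finite dimension is onto, so the left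
    inverse is two-sided.\<close>
  have dtdu: "dt u (du u w) = w" if "u \<in> W" for u w
  proof -
    have "u \<in> U" using that W(3) by auto
    then have "inj (dt u)" by (intro inj_on_inverseI[of _ "du u"] du_dt)
    then have "surj (dt u)"
      using dt_linear[of u] by (simp add: linear_injective_imp_surjective bounded_linear.linear)
    then obtain v where "w = dt u v" by blast
    then show ?thesis using du_dt[OF \<open>u \<in> U\<close>] by simp
  qed
  \<comment> \<open>Transport principle: a differential written in the forms
    \<open>dt u v $ \<beta>\<close> keeps its coefficients when expressed in flat coordinates. It is
    used for \<open>F\<close>, \<open>G\<close> and \<open>H\<close> in turn.\<close>
  have comp: "((\<lambda>p. g (?s p)) has_derivative (\<lambda>w. \<Sum>\<beta>\<in>UNIV. h \<beta> * w $ \<beta>)) (at (t u))"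
    if "u \<in> W" "(g has_derivative (\<lambda>v. \<Sum>\<beta>\<in>UNIV. h \<beta> * dt u v $ \<beta>)) (at u)" for g u h
  proof -
    have "(g has_derivative (\<lambda>v. \<Sum>\<beta>\<in>UNIV. h \<beta> * dt u v $ \<beta>)) (at (?s (t u)))"
      using that st by simp
    from has_derivative_compose[OF inv[OF that(1)] this] show ?thesis
      by (simp add: dtdu[OF that(1)])
  qed
  define Fh where "Fh p = F (?s p)" for p
  have G: "pd \<alpha> Fh (t u) = G \<alpha> u" if "u \<in> W" for u \<alpha>
    unfolding Fh_def[abs_def] using that W(3) by (intro pd_eqI comp F_deriv) auto
  have H: "pd \<beta> (pd \<alpha> Fh) (t u) = H \<alpha> \<beta> u" if "u \<in> W" for u \<alpha> \<beta>
  proof (rule pd_eq_on_open[OF W(4)])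
    show "((\<lambda>p. G \<alpha> (?s p)) has_derivative (\<lambda>w. \<Sum>\<beta>\<in>UNIV. H \<alpha> \<beta> u * w $ \<beta>)) (at (t u))"
      using that W(3) by (intro comp G_deriv) auto
  qed (use that in \<open>auto simp: st G\<close>)
  have C: "pd \<gamma> (pd \<beta> (pd \<alpha> Fh)) (t u) = correlator \<alpha> \<beta> \<gamma> u" if "u \<in> W" for u \<alpha> \<beta> \<gamma>
  proof (rule pd_eq_on_open[OF W(4)])
    show "((\<lambda>p. H \<alpha> \<beta> (?s p)) has_derivative (\<lambda>w. \<Sum>\<gamma>\<in>UNIV. correlator \<alpha> \<beta> \<gamma> u * w $ \<gamma>)) (at (t u))"
      using that W(3) by (intro comp) (auto simp: correlator_flat H_deriv)
  qed (use that in \<open>auto simp: st H\<close>)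
  have hol_t: "cholomorphic_on (\<lambda>u. t u $ i) W" for i
    unfolding cholomorphic_on_def
  proof (intro ballI exI conjI allI)
    fix u assume "u \<in> W"
    then show "((\<lambda>u. t u $ i) has_derivative (\<lambda>v. dt u v $ i)) (at u)"
      using W(3) by (intro bounded_linear.has_derivative[OF bounded_linear_vec_nth] t_deriv) auto
  qed (simp add: dt_def sum_3 algebra_simps)
  have hol_s: "cholomorphic_on (\<lambda>p. ?s p $ i) (t ` W)" for i
    unfolding cholomorphic_on_def
  proof safe
    fix u assume "u \<in> W"
    then have "((\<lambda>p. ?s p $ i) has_derivative (\<lambda>v. du u v $ i)) (at (t u))"
      by (intro bounded_linear.has_derivative[OF bounded_linear_vec_nth] inv)
    then show "\<exists>D. ((\<lambda>p. ?s p $ i) has_derivative D) (at (t u)) \<and> (\<forall>c v. D (c *s v) = c * D v)"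
      by (intro exI[of _ "\<lambda>v. du u v $ i"] conjI) (simp_all add: du_scale)
  qed
  have hol_F: "cholomorphic_on Fh (t ` W)"
    unfolding cholomorphic_on_def
  proof safe
    fix u assume "u \<in> W"
    then have "(Fh has_derivative (\<lambda>w. \<Sum>\<beta>\<in>UNIV. G \<beta> u * w $ \<beta>)) (at (t u))"
      unfolding Fh_def[abs_def] using W(3) by (intro comp F_deriv) auto
    then show "\<exists>D. (Fh has_derivative D) (at (t u)) \<and> (\<forall>c v. D (c *s v) = c * D v)"
      by (intro exI[of _ "\<lambda>w. \<Sum>\<beta>\<in>UNIV. G \<beta> u * w $ \<beta>"] conjI) (simp_all add: sum_3 algebra_simps)
  qed
  have contraction: "WDVV_contraction Fh (t u) \<alpha> \<beta> \<gamma> \<delta> =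
      (\<Sum>i\<in>UNIV. \<Psi> u $ i $ \<alpha> * \<Psi> u $ i $ \<beta> * \<Psi> u $ i $ \<gamma> * \<Psi> u $ i $ \<delta> / (\<Psi> u $ i $ 1)\<^sup>2)" if "u \<in> W" for u \<alpha> \<beta> \<gamma> \<delta>
  proof -
    have "correlator \<kappa> \<beta> \<alpha> u = correlator \<alpha> \<beta> \<kappa> u" "correlator \<delta> \<gamma> \<kappa> u = correlator \<kappa> \<gamma> \<delta> u" for \<kappa>
      by (simp_all add: correlator_def mult_ac)
    then show ?thesis
      using that W(3) correlator_contract[of u \<alpha> \<beta> \<gamma> \<delta>]
      unfolding WDVV_contraction_def matrix_inv_eta C[OF that] by auto
  qed
  have "WDVV_solution (- 2 * \<mu>) (vector [0, - \<mu>, - 2 * \<mu>]) (t ` W) Fh"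
    unfolding WDVV_solution_def
  \<comment> \<open>This potential is exactly homogeneous, so the quadratic correction is
    zero.\<close>
  proof (intro conjI ballI allI exI[of _ "\<lambda>_. 0"])
    show "open (t ` W)" "cholomorphic_on Fh (t ` W)" by fact+
    show "quadratic_polynomial (\<lambda>_. 0)"
      unfolding quadratic_polynomial_def
      by (intro exI[of _ "\<lambda>_ _. 0"] exI[of _ "\<lambda>_. 0"] exI[of _ 0]) simp
    fix p assume "p \<in> t ` W"
    then obtain u where u: "u \<in> W" "p = t u" by blast
    then have uU: "u \<in> U" using W(3) by auto
    show "WDVV_contraction Fh p \<alpha> \<beta> \<gamma> \<delta> = WDVV_contraction Fh p \<delta> \<beta> \<gamma> \<alpha>" for \<alpha> \<beta> \<gamma> \<delta>
      unfolding u(2) contraction[OF u(1)] by (simp add: mult_ac)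
    \<comment> \<open>An index 1 cancels the denominator of the correlator and leaves the
      orthogonality sum.\<close>
    show "pd 1 (pd \<alpha> (pd \<beta> Fh)) p = eta $ \<alpha> $ \<beta>" for \<alpha> \<beta>
      unfolding u(2) C[OF u(1)] using frame_nonzero[OF uU] frame_orth[OF uU, of \<beta> \<alpha>]
      by (simp add: correlator_def frame_orth[OF uU, symmetric] mult_ac)
    have "F u * (3 + 2 * \<mu>) = (\<Sum>\<alpha>\<in>UNIV. S 1 (dual_index \<alpha>) u * G \<alpha> u)"
      using resonance_factors_nonzero(6) by (simp add: F_def)
    also have "\<dots> = (\<Sum>\<alpha>\<in>UNIV. (1 + \<mu> - weight \<mu> \<alpha>) * t u $ \<alpha> * G \<alpha> u)"
      unfolding S_eq_H t_def by (simp add: weight_dual)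
    also have "\<dots> = (\<Sum>\<alpha>\<in>UNIV. (1 - vector [0, - \<mu>, - 2 * \<mu>] $ \<alpha>) * t u $ \<alpha> * G \<alpha> u)"
      by (simp add: sum_3 vector_3 algebra_simps)
    finally show "(\<Sum>\<alpha>\<in>UNIV. (1 - vector [0, - \<mu>, - 2 * \<mu>] $ \<alpha>) * p $ \<alpha> * pd \<alpha> Fh p)
        = (3 - - 2 * \<mu>) * Fh p + 0"
      unfolding u(2) G[OF u(1)] by (simp add: Fh_def st[OF u(1)] mult.commute)
  qed
  moreover have "biholomorphic_on t W"
    unfolding biholomorphic_on_def using W hol_t hol_s by blast
  moreover have "Fh (t u) = F u" if "u \<in> W" for u
    using that by (simp add: Fh_def st)
  ultimately show ?thesis using that W by metis
qed

end

section \<open>The Omega system of a Painleve VI transcendent\<close>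

text \<open>Eliminating \<open>y'\<close> in favour of \<open>A\<close> turns PVI into a first-order equation for \<open>A\<close>.\<close>

lemma PVI_imp_Afun_deriv_identity:
  fixes x y d A \<mu> :: complex
  assumes nz: "x \<noteq> 0" "x \<noteq> 1" "y \<noteq> 0" "y \<noteq> 1" "y \<noteq> x"
    and A: "A = 1/2 * (d * x * (x - 1) - y * (y - 1))"
  shows "1/2 * ((1/2 * (1/y + 1/(y - 1) + 1/(y - x)) * d\<^sup>2
          - (1/x + 1/(x - 1) + 1/(y - x)) * d
          + 1/2 * (y * (y - 1) * (y - x)) / (x\<^sup>2 * (x - 1)\<^sup>2)
              * ((2*\<mu> - 1)\<^sup>2 + x * (x - 1) / (y - x)\<^sup>2)) * (x * (x - 1)) + d * (2*x - 1) - d * (2*y - 1))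
     = (A\<^sup>2 * (1/y + 1/(y - 1) + 1/(y - x)) + A * (x + y - 1)
         + \<mu> * (\<mu> - 1) * y * (y - 1) * (y - x)) / (x * (x - 1))"
proof -
  have d: "d = (2*A + y*(y-1)) / (x*(x-1))"
    unfolding A using nz by (simp add: field_simps)
  have nz': "x - 1 \<noteq> 0" "y - 1 \<noteq> 0" "y - x \<noteq> 0" using nz by auto
  show ?thesis
    unfolding d using nz nz' by (simp add: divide_simps power2_eq_square) algebra
qed

text \<open>Each \<Omega> is a prefactor of square roots times a bracket. With the prefactor divided
  out, the left side is its logarithmic derivative times the bracket plus the derivative of the
  bracket, and the right side is the product of the two other brackets. The differential system has
  thus become rational in x, y, A.\<close>

lemma Omega_deriv_identities:
  fixes x y A \<mu> :: complex
  assumes nz: "x \<noteq> 0" "x \<noteq> 1" "y \<noteq> 0" "y \<noteq> 1" "y \<noteq> x"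
    and d: "d = (2*A + y*(y-1)) / (x*(x-1))"
    and dA: "dA = (A\<^sup>2 * (1/y + 1/(y - 1) + 1/(y - x)) + A * (x + y - 1)
         + \<mu> * (\<mu> - 1) * y * (y - 1) * (y - x)) / (x * (x - 1))"
  shows "1/2 * (d/(y-1) + (d-1)/(y-x) - 1/x) * (A / ((y-1)*(y-x)) + \<mu>) + (dA * ((y-1)*(y-x)) - A * (d*(y-x) + (y-1)*(d-1))) / ((y-1)*(y-x))\<^sup>2
      = y / (x*(x-1)) * (A / (y*(y-x)) + \<mu>) * (A / (y*(y-1)) + \<mu>)" (is ?A)
   and "1/2 * (d/y + (d-1)/(y-x) - 1/(x-1)) * (A / (y*(y-x)) + \<mu>) + (dA * (y*(y-x)) - A * (d*(y-x) + y*(d-1))) / (y*(y-x))\<^sup>2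
      = (y-1) / (x*(x-1)) * (A / ((y-1)*(y-x)) + \<mu>) * (A / (y*(y-1)) + \<mu>)" (is ?B)
   and "1/2 * (d/y + d/(y-1) - 1/x - 1/(x-1)) * (A / (y*(y-1)) + \<mu>) + (dA * (y*(y-1)) - A * (d*(y-1) + y*d)) / (y*(y-1))\<^sup>2
      = (y-x) / (x*(x-1)) * (A / ((y-1)*(y-x)) + \<mu>) * (A / (y*(y-x)) + \<mu>)" (is ?C)
proof -
  have nz': "x - 1 \<noteq> 0" "y - 1 \<noteq> 0" "y - x \<noteq> 0" using nz by auto
  show ?A unfolding d dA using nz nz' by (simp add: divide_simps power2_eq_square) algebra
  show ?B unfolding d dA using nz nz' by (simp add: divide_simps power2_eq_square) algebra
  show ?C unfolding d dA using nz nz' by (simp add: divide_simps power2_eq_square) algebra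
qed

text \<open>The first relation says that V has the eigenvalues 0, \<mu>, -\<mu>. In the second, the
  outer parenthesis on the left is the logarithmic derivative of k (y - 1) / (x - 1) in x, halved
  for the root f; the relation states f'/f = - \<Omega>1 E33 / (x - 1).\<close>

lemma Omega_squares:
  fixes x y A \<mu> p q r s w :: complex
  assumes nz: "x \<noteq> 0" "x \<noteq> 1" "y \<noteq> 0" "y \<noteq> 1" "y \<noteq> x"
    and sq: "p\<^sup>2 = y" "q\<^sup>2 = y - 1" "r\<^sup>2 = y - x" "s\<^sup>2 = x" "w\<^sup>2 = 1 - x"
    and O1: "O1 = \<i> * (q * r / s) * (A / ((y - 1) * (y - x)) + \<mu>)"
    and O2: "O2 = \<i> * (p * r / w) * (A / (y * (y - x)) + \<mu>)"
    and O3: "O3 = - (p * q / (s * w)) * (A / (y * (y - 1)) + \<mu>)"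
  shows "O1\<^sup>2 + O2\<^sup>2 + O3\<^sup>2 = - \<mu>\<^sup>2" (is ?A)
    and "1/2 * ((2*\<mu> - 1) * (y - x) / (x * (x - 1)) + (2*A + y*(y-1)) / (x*(x-1)) / (y - 1) - 1/(x - 1)) * (x - 1) * (O1\<^sup>2 + O3\<^sup>2)
       = O1 * (O2 * O3 - \<mu> * O1)" (is ?B)
proof -
  have nz': "x - 1 \<noteq> 0" "1 - x \<noteq> 0" "y - 1 \<noteq> 0" "y - x \<noteq> 0" using nz by auto
  have a: "O1\<^sup>2 = - ((y-1)*(y-x)/x * (A / ((y - 1) * (y - x)) + \<mu>)\<^sup>2)"
    unfolding O1 power_mult_distrib power_divide sq by simp
  have b: "O2\<^sup>2 = - (y*(y-x)/(1-x) * (A / (y * (y - x)) + \<mu>)\<^sup>2)"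
    unfolding O2 power_mult_distrib power_divide sq by simp
  have c: "O3\<^sup>2 = y*(y-1)/(x*(1-x)) * (A / (y * (y - 1)) + \<mu>)\<^sup>2"
    unfolding O3 power_mult_distrib power_divide power2_minus sq by simp
  \<comment> \<open>Every root occurs exactly twice in the triple product, so the choice of branches
    drops out.\<close>
  have prod: "\<i>*(q*r/s)*a1 * (\<i>*(p*r/w)*a2) * (- (p*q/(s*w))*a3) = (p\<^sup>2*q\<^sup>2*r\<^sup>2/(s\<^sup>2*w\<^sup>2)) * a1 * a2 * a3" for a1 a2 a3
    by (simp add: power2_eq_square algebra_simps)
  have "O1*O2*O3 = (p\<^sup>2*q\<^sup>2*r\<^sup>2/(s\<^sup>2*w\<^sup>2)) * (A / ((y - 1) * (y - x)) + \<mu>) * (A / (y * (y - x)) + \<mu>) * (A / (y * (y - 1)) + \<mu>)"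
    unfolding O1 O2 O3 using prod by simp
  then have e: "O1*O2*O3 = (y*(y-1)*(y-x)/(x*(1-x))) * (A / ((y - 1) * (y - x)) + \<mu>) * (A / (y * (y - x)) + \<mu>) * (A / (y * (y - 1)) + \<mu>)"
    unfolding sq .
  show ?A unfolding a b c using nz nz' by (simp add: divide_simps power2_eq_square) algebra
  have f: "O1 * (O2 * O3 - \<mu> * O1) = O1*O2*O3 - \<mu> * O1\<^sup>2" by (simp add: algebra_simps power2_eq_square)
  show ?B unfolding f e a c using nz nz' by (simp add: divide_simps power2_eq_square) algebra
qed

text \<open>The equations in x for the two outer columns, entry by entry, where l is the logarithmic
  derivative of the scale g. The first column is taken without its common factor
  1/(2\<mu>^2).\<close>

lemma E_deriv_identities:
  fixes x \<mu> O1 O2 O3 l :: complex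
  assumes nz: "x \<noteq> 0" "x \<noteq> 1" "\<mu> \<noteq> 0" and D: "O1\<^sup>2 + O3\<^sup>2 \<noteq> 0"
    and sum: "O1\<^sup>2 + O2\<^sup>2 + O3\<^sup>2 = - \<mu>\<^sup>2"
    and l: "l * (x - 1) * (O1\<^sup>2 + O3\<^sup>2) = O1 * (O2 * O3 - \<mu> * O1)"
    and d1: "d1 = O2 * O3 / x" and d2: "d2 = - O1 * O3 / (x-1)" and d3: "d3 = O1 * O2 / (x * (x - 1))"
  shows "(d1 * O2 + O1 * d2 - \<mu> * d3) - l * (O1 * O2 - \<mu> * O3) = O2 * (O2 * O3 + \<mu> * O1) / x"
    and "- (2 * O1 * d1 + 2 * O3 * d3) + l * (O1\<^sup>2 + O3\<^sup>2) = - O1 * (O2 * O3 + \<mu> * O1) / (x - 1)"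
    and "(d2 * O3 + O2 * d3 + \<mu> * d1) - l * (O2 * O3 + \<mu> * O1)
        = - O2 * (O1 * O2 - \<mu> * O3) / x - O1 * (O1\<^sup>2 + O3\<^sup>2) / (x - 1)"
    and "(- (d1 * O2 + O1 * d2 + \<mu> * d3) * (O1\<^sup>2 + O3\<^sup>2) + (O1 * O2 + \<mu> * O3) * (2 * O1 * d1 + 2 * O3 * d3)) / (O1\<^sup>2 + O3\<^sup>2)\<^sup>2
          - l * (O1 * O2 + \<mu> * O3) / (O1\<^sup>2 + O3\<^sup>2)
        = - O2 * (O2 * O3 - \<mu> * O1) / (O1\<^sup>2 + O3\<^sup>2) / x" (is ?D)
    and "l = O1 * (O2 * O3 - \<mu> * O1) / (O1\<^sup>2 + O3\<^sup>2) / (x - 1)" (is ?E)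
    and "(- (d2 * O3 + O2 * d3 - \<mu> * d1) * (O1\<^sup>2 + O3\<^sup>2) + (O2 * O3 - \<mu> * O1) * (2 * O1 * d1 + 2 * O3 * d3)) / (O1\<^sup>2 + O3\<^sup>2)\<^sup>2
          - l * (O2 * O3 - \<mu> * O1) / (O1\<^sup>2 + O3\<^sup>2)
        = O2 * (O1 * O2 + \<mu> * O3) / (O1\<^sup>2 + O3\<^sup>2) / x + O1 / (x - 1)" (is ?F)
proof -
  have nz': "x - 1 \<noteq> 0" using nz by auto
  show E: ?E using l nz' D by (simp add: eq_divide_eq mult_ac)
  have D2: "(O1\<^sup>2 + O3\<^sup>2)\<^sup>2 = (O1\<^sup>2 + O3\<^sup>2) * (O1\<^sup>2 + O3\<^sup>2)" by (simp add: power2_eq_square)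
  have D': "O1*O1 + O3*O3 \<noteq> 0" using D by (simp add: power2_eq_square)
  show "(d1 * O2 + O1 * d2 - \<mu> * d3) - l * (O1 * O2 - \<mu> * O3) = O2 * (O2 * O3 + \<mu> * O1) / x"
    unfolding E d1 d2 d3 using nz nz' D D' sum by (simp add: divide_simps power2_eq_square) algebra
  show "- (2 * O1 * d1 + 2 * O3 * d3) + l * (O1\<^sup>2 + O3\<^sup>2) = - O1 * (O2 * O3 + \<mu> * O1) / (x - 1)"
    unfolding E d1 d2 d3 using nz nz' D D' by (simp add: divide_simps power2_eq_square) (simp add: algebra_simps)
  show "(d2 * O3 + O2 * d3 + \<mu> * d1) - l * (O2 * O3 + \<mu> * O1)
        = - O2 * (O1 * O2 - \<mu> * O3) / x - O1 * (O1\<^sup>2 + O3\<^sup>2) / (x - 1)"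
    unfolding E d1 d2 d3 using nz nz' D D' sum by (simp add: divide_simps power2_eq_square) algebra
  show ?D
    unfolding E d1 d2 d3 D2 using nz nz' D D' sum by (simp add: divide_simps power2_eq_square) algebra
  show ?F
    unfolding E d1 d2 d3 D2 using nz nz' D D' sum by (simp add: divide_simps power2_eq_square) algebra
qed

section \<open>Differentiating continuous branches\<close>

lemma isCont_tendsto_nhds:
  assumes "isCont f a"
  shows "(f \<longlongrightarrow> f a) (nhds a)"
  using assms unfolding continuous_at tendsto_at_iff_tendsto_nhds .

text \<open>Near \<open>z0\<close> the quotient of r by its value there is close to 1, hence in the
  right half-plane, where the principal root inverts squaring. No sign ambiguity survives
  locally.\<close>

lemma sqrt_branch_eq_csqrt:
  fixes z0 :: "'a::t2_space"
  assumes "open S" "sqrt_branch S g r" "z0 \<in> S" "g z0 \<noteq> 0"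
  shows "eventually (\<lambda>z. r z = r z0 * csqrt (g z / g z0)) (nhds z0)"
proof -
  have sq: "\<And>z. z \<in> S \<Longrightarrow> (r z)\<^sup>2 = g z" and cont: "continuous_on S r"
    using assms(2) unfolding sqrt_branch_def by auto
  have r0: "r z0 \<noteq> 0" using sq[OF assms(3)] assms(4) by auto
  have "isCont r z0" using cont assms(1,3) by (simp add: continuous_on_eq_continuous_at)
  then have "(r \<longlongrightarrow> r z0) (nhds z0)" by (rule isCont_tendsto_nhds)
  then have "((\<lambda>z. r z / r z0) \<longlongrightarrow> r z0 / r z0) (nhds z0)"
    using r0 by (intro tendsto_intros) auto
  then have "((\<lambda>z. Re (r z / r z0)) \<longlongrightarrow> Re 1) (nhds z0)"
    using r0 by (intro tendsto_intros) auto
  then have "eventually (\<lambda>z. Re (r z / r z0) > 0) (nhds z0)"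
    by (rule order_tendstoD) simp
  moreover have "eventually (\<lambda>z. z \<in> S) (nhds z0)"
    using assms(1,3) by (rule eventually_nhds_in_open)
  ultimately show ?thesis
  proof eventually_elim
    case (elim z)
    have "g z / g z0 = (r z / r z0)\<^sup>2"
      using sq elim(2) assms(3) by (simp add: power_divide)
    moreover have "csqrt ((r z / r z0)\<^sup>2) = r z / r z0"
      using elim(1) by (intro csqrt_square) auto
    ultimately have "csqrt (g z / g z0) = r z / r z0" by (simp only:)
    then show ?case using r0 by simp
  qed
qed

lemma sqrt_branch_has_field_derivative:
  assumes "open S" "sqrt_branch S g r" "z \<in> S" "g z \<noteq> 0"
    and g: "(g has_field_derivative g') (at z)"
  shows "(r has_field_derivative r z * (g' / g z / 2)) (at z)"
proof -
  have r2: "(r z)\<^sup>2 = g z" using assms(2,3) unfolding sqrt_branch_def by auto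
  then have r0: "r z \<noteq> 0" using assms(4) by auto
  have "((\<lambda>w. r z * csqrt (g w / g z)) has_field_derivative r z * (g' / g z / 2)) (at z)"
    by (rule DERIV_cong[OF DERIV_cmult[OF has_field_derivative_csqrt'[OF DERIV_cdivide[OF g]]]])
      (use assms(4) in \<open>auto simp: complex_nonpos_Reals_iff\<close>)
  moreover have "eventually (\<lambda>w. r z * csqrt (g w / g z) = r w) (nhds z)"
    using sqrt_branch_eq_csqrt[OF assms(1-4)] by (rule eventually_mono) (rule sym)
  ultimately show ?thesis
    by (simp only: DERIV_cong_ev[OF refl _ refl])
qed

lemma log_branch_has_field_derivative:
  fixes l :: "complex \<Rightarrow> complex"
  assumes "open L" "continuous_on L l" "\<And>H. H \<in> L \<Longrightarrow> exp (l H) = H" "H \<in> L"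
  shows "(l has_field_derivative 1 / H) (at H)"
proof -
  have "(exp has_field_derivative H) (at (l H))"
    using DERIV_exp[of "l H"] assms(3,4) by simp
  moreover have "H \<noteq> 0" using assms(3,4) by (metis exp_not_eq_zero)
  moreover have "isCont l H" using assms by (simp add: continuous_on_eq_continuous_at)
  ultimately have "(l has_field_derivative inverse H) (at H)"
    using assms(1,3,4) by (intro has_field_derivative_inverse_basic[of exp])
  then show ?thesis by (simp add: inverse_eq_divide)
qed

text \<open>Logarithmic derivatives add up and keep the function as an explicit factor, so the
  prefactor of square roots can later be split off unchanged.\<close>

lemma quotient_log_deriv:
  fixes f g h :: "complex \<Rightarrow> complex"
  assumes f: "(f has_field_derivative f x * a) (at x)" and g: "(g has_field_derivative g x * b) (at x)"
   and h: "(h has_field_derivative h x * c) (at x)" and "h x \<noteq> 0"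
  shows "((\<lambda>x. k * (f x * g x / h x)) has_field_derivative k * (f x * g x / h x) * (a + b - c)) (at x)"
proof -
  have "((\<lambda>x. k * (f x * g x / h x)) has_field_derivative k * (((f x * a * g x + g x * b * f x) * h x - f x * g x * (h x * c)) / (h x * h x))) (at x)"
    by (intro DERIV_cmult DERIV_divide DERIV_mult assms)
  moreover have "k * (((f x * a * g x + g x * b * f x) * h x - f x * g x * (h x * c)) / (h x * h x)) = k * (f x * g x / h x) * (a + b - c)"
    using assms(4) by (simp add: divide_simps) (simp add: algebra_simps)
  ultimately show ?thesis by (simp only:)
qed
lemma mult_log_deriv:
  fixes f g :: "complex \<Rightarrow> complex"
  assumes f: "(f has_field_derivative f x * a) (at x)" and g: "(g has_field_derivative g x * b) (at x)"
  shows "((\<lambda>x. f x * g x) has_field_derivative f x * g x * (a + b)) (at x)"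
  by (rule DERIV_cong[OF DERIV_mult[OF f g]]) (simp add: algebra_simps)
text \<open>For prefactor times bracket: only the prefactor \<open>c\<close> is differentiated
  logarithmically, and the expression left after splitting it off has the shape of
  \<open>Omega_deriv_identities\<close>.\<close>

lemma mult_semilog_deriv:
  fixes f g :: "complex \<Rightarrow> complex"
  assumes f: "(f has_field_derivative c * a) (at x)" and g: "(g has_field_derivative b) (at x)" and "f x = c"
  shows "((\<lambda>x. f x * g x) has_field_derivative c * (a * g x + b)) (at x)"
  by (rule DERIV_cong[OF DERIV_mult[OF f g]]) (simp add: algebra_simps assms(3))

section \<open>The differential system for the Omegas\<close>

lemma Afun_has_field_derivative:
  assumes "PVI_solution_on \<mu> X y" "x \<in> X"
  shows "(y has_field_derivative (2 * Afun y x + y x * (y x - 1)) / (x * (x - 1))) (at x)"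
    and "(Afun y has_field_derivative ((Afun y x)\<^sup>2 * (1/y x + 1/(y x - 1) + 1/(y x - x)) + Afun y x * (x + y x - 1)
         + \<mu> * (\<mu> - 1) * y x * (y x - 1) * (y x - x)) / (x * (x - 1))) (at x)"
proof -
  have op: "open X" and hol: "y holomorphic_on X" and x: "x \<noteq> 0" "x \<noteq> 1"
    and y: "y x \<noteq> 0" "y x \<noteq> 1" "y x \<noteq> x"
    using assms unfolding PVI_solution_on_def by auto
  have dy: "(y has_field_derivative deriv y x) (at x)"
    using hol op assms(2) by (rule holomorphic_derivI)
  have "deriv y holomorphic_on X" using hol op by (rule holomorphic_deriv)
  then have ddy: "(deriv y has_field_derivative deriv (deriv y) x) (at x)"
    using op assms(2) by (rule holomorphic_derivI)
  have d: "deriv y x = (2 * Afun y x + y x * (y x - 1)) / (x * (x - 1))"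
    using x by (simp add: Afun_def divide_simps)
  with dy show "(y has_field_derivative (2 * Afun y x + y x * (y x - 1)) / (x * (x - 1))) (at x)" by simp
  have dd: "(Afun y has_field_derivative 1/2 * (deriv (deriv y) x * (x * (x - 1)) + deriv y x * (2*x - 1)
      - deriv y x * (2 * y x - 1))) (at x)"
    unfolding Afun_def[abs_def]
    by (rule DERIV_cong[OF DERIV_cmult[OF DERIV_diff[OF DERIV_mult[OF DERIV_mult[OF ddy DERIV_ident] DERIV_diff[OF DERIV_ident DERIV_const]]
          DERIV_mult[OF dy DERIV_diff[OF dy DERIV_const]]]]]) (simp add: algebra_simps)
  have eq: "deriv (deriv y) x =
          1/2 * (1 / y x + 1 / (y x - 1) + 1 / (y x - x)) * (deriv y x)\<^sup>2
          - (1 / x + 1 / (x - 1) + 1 / (y x - x)) * deriv y x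
          + 1/2 * (y x * (y x - 1) * (y x - x)) / (x\<^sup>2 * (x - 1)\<^sup>2)
              * ((2 * \<mu> - 1)\<^sup>2 + x * (x - 1) / (y x - x)\<^sup>2)"
    using assms unfolding PVI_solution_on_def by blast
  have "Afun y x = 1/2 * (deriv y x * x * (x - 1) - y x * (y x - 1))" by (rule Afun_def)
  note alg = PVI_imp_Afun_deriv_identity[OF x y this, of \<mu>, folded eq]
  show "(Afun y has_field_derivative ((Afun y x)\<^sup>2 * (1/y x + 1/(y x - 1) + 1/(y x - x)) + Afun y x * (x + y x - 1)
         + \<mu> * (\<mu> - 1) * y x * (y x - 1) * (y x - x)) / (x * (x - 1))) (at x)"
    by (rule DERIV_cong[OF dd alg])
qed

lemma Omega_has_field_derivative:
  assumes P: "PVI_solution_on \<mu> X y" and x: "x \<in> X" and adm: "admissible_branches \<mu> k0 y X L B"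
  shows "(Omega1 \<mu> y B has_field_derivative Omega2 \<mu> y B x * Omega3 \<mu> y B x / x) (at x)" (is ?A)
    and "(Omega2 \<mu> y B has_field_derivative - Omega1 \<mu> y B x * Omega3 \<mu> y B x / (x - 1)) (at x)" (is ?B)
    and "(Omega3 \<mu> y B has_field_derivative Omega1 \<mu> y B x * Omega2 \<mu> y B x / (x * (x - 1))) (at x)" (is ?C)
proof -
  have op: "open X" and nz: "x \<noteq> 0" "x \<noteq> 1" "y x \<noteq> 0" "y x \<noteq> 1" "y x \<noteq> x"
    using P x unfolding PVI_solution_on_def by auto
  define d where "d = (2 * Afun y x + y x * (y x - 1)) / (x * (x - 1))"
  define dA where "dA = ((Afun y x)\<^sup>2 * (1/y x + 1/(y x - 1) + 1/(y x - x)) + Afun y x * (x + y x - 1)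
         + \<mu> * (\<mu> - 1) * y x * (y x - 1) * (y x - x)) / (x * (x - 1))"
  have dy: "(y has_field_derivative d) (at x)" and dA': "(Afun y has_field_derivative dA) (at x)"
    unfolding d_def dA_def using Afun_has_field_derivative[OF P x] by auto
  have br: "sqrt_branch X y (sqrt_y B)" "sqrt_branch X (\<lambda>x. y x - 1) (sqrt_y1 B)"
     "sqrt_branch X (\<lambda>x. y x - x) (sqrt_yx B)" "sqrt_branch X (\<lambda>x. x) (sqrt_x B)"
     "sqrt_branch X (\<lambda>x. 1 - x) (sqrt_1x B)"
    using adm unfolding admissible_branches_def by auto
  define p q r s w where pqr: "p = sqrt_y B x" "q = sqrt_y1 B x" "r = sqrt_yx B x" "s = sqrt_x B x" "w = sqrt_1x B x"
  have sq: "p\<^sup>2 = y x" "q\<^sup>2 = y x - 1" "r\<^sup>2 = y x - x" "s\<^sup>2 = x" "w\<^sup>2 = 1 - x"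
    using br x unfolding sqrt_branch_def pqr by auto
  have w2: "- (w\<^sup>2) = x - 1" using sq by simp
  have nz': "sqrt_x B x \<noteq> 0" "sqrt_1x B x \<noteq> 0"
    using sq(4,5) nz unfolding pqr by auto
  have d1: "((\<lambda>x. y x - c) has_field_derivative d) (at x)" for c
    using DERIV_diff[OF dy DERIV_const] by simp
  have d2: "((\<lambda>x. y x - x) has_field_derivative d - 1) (at x)"
    using DERIV_diff[OF dy DERIV_ident] by simp
  have d3: "((\<lambda>x. 1 - x) has_field_derivative - 1) (at x)"
    using DERIV_diff[OF DERIV_const DERIV_ident] by simp
  have dp: "(sqrt_y B has_field_derivative sqrt_y B x * (d / y x / 2)) (at x)"
    by (rule sqrt_branch_has_field_derivative[OF op br(1) x nz(3) dy])
  have dq: "(sqrt_y1 B has_field_derivative sqrt_y1 B x * (d / (y x - 1) / 2)) (at x)"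
    by (rule sqrt_branch_has_field_derivative[OF op br(2) x _ d1]) (use nz in simp)
  have dr: "(sqrt_yx B has_field_derivative sqrt_yx B x * ((d - 1) / (y x - x) / 2)) (at x)"
    by (rule sqrt_branch_has_field_derivative[OF op br(3) x _ d2]) (use nz in simp)
  have ds: "(sqrt_x B has_field_derivative sqrt_x B x * (1 / x / 2)) (at x)"
    by (rule sqrt_branch_has_field_derivative[OF op br(4) x nz(1) DERIV_ident])
  have "- 1 / (1 - x) = 1 / (x - 1)" using nz by (simp add: divide_simps)
  then have dw: "(sqrt_1x B has_field_derivative sqrt_1x B x * (1 / (x - 1) / 2)) (at x)"
    using sqrt_branch_has_field_derivative[OF op br(5) x _ d3] nz by simp
  define N1 N2 N3 where N: "N1 = Afun y x / ((y x - 1) * (y x - x)) + \<mu>"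
     "N2 = Afun y x / (y x * (y x - x)) + \<mu>" "N3 = Afun y x / (y x * (y x - 1)) + \<mu>"
  note Oalg = Omega_deriv_identities[OF nz d_def dA_def]
  have O: "Omega1 \<mu> y B x = \<i> * (q * r / s) * N1" "Omega2 \<mu> y B x = \<i> * (p * r / w) * N2"
     "Omega3 \<mu> y B x = - (p * q / (s * w)) * N3"
    unfolding N pqr Omega1_def Omega2_def Omega3_def by auto
  have nzy: "y x - 1 \<noteq> 0" "y x - x \<noteq> 0" using nz by auto
  have P1: "((\<lambda>x. \<i> * (sqrt_y1 B x * sqrt_yx B x / sqrt_x B x)) has_field_derivative
      \<i> * (q * r / s) * (1/2 * (d/(y x-1) + (d-1)/(y x-x) - 1/x))) (at x)"
    unfolding pqr by (rule DERIV_cong[OF quotient_log_deriv[OF dq dr ds nz'(1)]]) (simp add: algebra_simps)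
  have P2: "((\<lambda>x. \<i> * (sqrt_y B x * sqrt_yx B x / sqrt_1x B x)) has_field_derivative
      \<i> * (p * r / w) * (1/2 * (d/y x + (d-1)/(y x-x) - 1/(x-1)))) (at x)"
    unfolding pqr by (rule DERIV_cong[OF quotient_log_deriv[OF dp dr dw nz'(2)]]) (simp add: algebra_simps)
  have nz'': "sqrt_x B x * sqrt_1x B x \<noteq> 0" using nz' by simp
  have P3: "((\<lambda>x. - (sqrt_y B x * sqrt_y1 B x / (sqrt_x B x * sqrt_1x B x))) has_field_derivative
      - (p * q / (s * w)) * (1/2 * (d/y x + d/(y x-1) - 1/x - 1/(x-1)))) (at x)"
    unfolding pqr
    by (rule DERIV_cong[OF DERIV_minus[OF quotient_log_deriv[where k = 1, OF dp dq mult_log_deriv[OF ds dw] nz''],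
          unfolded mult_1_left]]) (simp add: algebra_simps)
  have quot: "((\<lambda>x. Afun y x / (f x * g x) + \<mu>) has_field_derivative
       (dA * (f x * g x) - Afun y x * (df * g x + f x * dg)) / (f x * g x)\<^sup>2) (at x)"
    if "(f has_field_derivative df) (at x)" "(g has_field_derivative dg) (at x)" "f x * g x \<noteq> 0" for f g df dg
    by (rule DERIV_cong[OF DERIV_add[OF DERIV_divide[OF dA' DERIV_mult[OF that(1,2)] that(3)] DERIV_const]])
      (simp add: power2_eq_square algebra_simps)
  note M1 = quot[OF d1[of 1] d2] and M2 = quot[OF dy d2] and M3 = quot[OF dy d1[of 1]]
  have "(Omega1 \<mu> y B has_field_derivative \<i> * (q * r / s) * (y x / (x*(x-1)) * N2 * N3)) (at x)"
    unfolding Omega1_def[abs_def] N Oalg(1)[symmetric]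
    by (rule mult_semilog_deriv[OF P1 M1]) (use nz in \<open>simp_all add: pqr\<close>)
  \<comment> \<open>Conversely, the product of the two other \<Omega> contains the prefactor of the
    first one; the surplus roots pair up to squares, which are rational.\<close>
  moreover have "\<i> * (p * r / w) * N2 * (- (p * q / (s * w)) * N3) / x = \<i> * (q * r / s) * (p\<^sup>2 / (x*(- (w\<^sup>2))) * N2 * N3)"
    by (simp add: power2_eq_square mult_ac)
  ultimately show ?A unfolding O sq(1) w2 by (simp only:)
  have "(Omega2 \<mu> y B has_field_derivative \<i> * (p * r / w) * ((y x - 1) / (x*(x-1)) * N1 * N3)) (at x)"
    unfolding Omega2_def[abs_def] N Oalg(2)[symmetric]
    by (rule mult_semilog_deriv[OF P2 M2]) (use nz in \<open>simp_all add: pqr\<close>)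
  moreover have "- (\<i> * (q * r / s) * N1) * (- (p * q / (s * w)) * N3) / (x - 1)
      = \<i> * (p * r / w) * (q\<^sup>2 / (s\<^sup>2 * (x - 1)) * N1 * N3)"
    by (simp add: power2_eq_square mult_ac)
  ultimately show ?B unfolding O sq(2,4) by (simp only:)
  have "(Omega3 \<mu> y B has_field_derivative - (p * q / (s * w)) * ((y x - x) / (x*(x-1)) * N1 * N2)) (at x)"
    unfolding Omega3_def[abs_def] N Oalg(3)[symmetric]
    by (rule mult_semilog_deriv[OF P3 M3]) (use nz in \<open>simp_all add: pqr\<close>)
  moreover have "\<i> * (q * r / s) * N1 * (\<i> * (p * r / w) * N2) / (x * (x - 1))
      = - (p * q / (s * w)) * (r\<^sup>2 / (x * (x - 1)) * N1 * N2)"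
    by (simp add: power2_eq_square mult_ac)
  ultimately show ?C unfolding O sq(3) by (simp only:)
qed

section \<open>The eigenvector matrix\<close>

lemma E_entries:
  "E \<mu> y B x $ 1 $ 1 = (Omega1 \<mu> y B x * Omega2 \<mu> y B x - \<mu> * Omega3 \<mu> y B x) / (2 * \<mu>\<^sup>2)"
  "E \<mu> y B x $ 2 $ 1 = - ((Omega1 \<mu> y B x)\<^sup>2 + (Omega3 \<mu> y B x)\<^sup>2) / (2 * \<mu>\<^sup>2)"
  "E \<mu> y B x $ 3 $ 1 = (Omega2 \<mu> y B x * Omega3 \<mu> y B x + \<mu> * Omega1 \<mu> y B x) / (2 * \<mu>\<^sup>2)"
  "E \<mu> y B x $ 1 $ 2 = Omega1 \<mu> y B x / (\<i> * \<mu>)"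
  "E \<mu> y B x $ 2 $ 2 = Omega2 \<mu> y B x / (\<i> * \<mu>)"
  "E \<mu> y B x $ 3 $ 2 = Omega3 \<mu> y B x / (\<i> * \<mu>)"
  "E \<mu> y B x $ 1 $ 3 = - (Omega1 \<mu> y B x * Omega2 \<mu> y B x + \<mu> * Omega3 \<mu> y B x) / ((Omega1 \<mu> y B x)\<^sup>2 + (Omega3 \<mu> y B x)\<^sup>2)"
  "E \<mu> y B x $ 2 $ 3 = 1"
  "E \<mu> y B x $ 3 $ 3 = - (Omega2 \<mu> y B x * Omega3 \<mu> y B x - \<mu> * Omega1 \<mu> y B x) / ((Omega1 \<mu> y B x)\<^sup>2 + (Omega3 \<mu> y B x)\<^sup>2)"
  by (simp_all add: E_def Let_def vector_3)

text \<open>Here g plays the part of f without its power of H. As \<open>eta\<close> pairs column 1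
  with column 3, the reciprocal scales preserve orthogonality.\<close>

definition scaled_E :: "complex \<Rightarrow> (complex \<Rightarrow> complex) \<Rightarrow> branches \<Rightarrow> (complex \<Rightarrow> complex) \<Rightarrow> complex \<Rightarrow> complex ^ 3 ^ 3" where
  "scaled_E \<mu> y B g x = (\<chi> j \<alpha>. E \<mu> y B x $ j $ \<alpha> * (vector [inverse (g x), 1, g x] :: complex ^ 3) $ \<alpha>)"

lemma scaled_E_entries:
  "scaled_E \<mu> y B g x $ j $ 1 = E \<mu> y B x $ j $ 1 / g x"
  "scaled_E \<mu> y B g x $ j $ 2 = E \<mu> y B x $ j $ 2"
  "scaled_E \<mu> y B g x $ j $ 3 = E \<mu> y B x $ j $ 3 * g x"
  by (simp_all add: scaled_E_def vector_3 divide_inverse)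

lemma Omega_identities:
  assumes P: "PVI_solution_on \<mu> X y" and x: "x \<in> X" and adm: "admissible_branches \<mu> k0 y X L B"
  shows "(Omega1 \<mu> y B x)\<^sup>2 + (Omega2 \<mu> y B x)\<^sup>2 + (Omega3 \<mu> y B x)\<^sup>2 = - \<mu>\<^sup>2"
    and "1/2 * ((2*\<mu> - 1) * (y x - x) / (x * (x - 1)) + (2 * Afun y x + y x * (y x - 1)) / (x * (x - 1)) / (y x - 1) - 1/(x - 1))
         * (x - 1) * ((Omega1 \<mu> y B x)\<^sup>2 + (Omega3 \<mu> y B x)\<^sup>2)
       = Omega1 \<mu> y B x * (Omega2 \<mu> y B x * Omega3 \<mu> y B x - \<mu> * Omega1 \<mu> y B x)"
proof -
  have nz: "x \<noteq> 0" "x \<noteq> 1" "y x \<noteq> 0" "y x \<noteq> 1" "y x \<noteq> x"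
    using P x unfolding PVI_solution_on_def by auto
  have sq: "(sqrt_y B x)\<^sup>2 = y x" "(sqrt_y1 B x)\<^sup>2 = y x - 1" "(sqrt_yx B x)\<^sup>2 = y x - x" "(sqrt_x B x)\<^sup>2 = x"
    "(sqrt_1x B x)\<^sup>2 = 1 - x"
    using adm x unfolding admissible_branches_def sqrt_branch_def by auto
  note * = Omega_squares[OF nz sq Omega1_def[of \<mu> y B x] Omega2_def[of \<mu> y B x] Omega3_def[of \<mu> y B x]]
  show "(Omega1 \<mu> y B x)\<^sup>2 + (Omega2 \<mu> y B x)\<^sup>2 + (Omega3 \<mu> y B x)\<^sup>2 = - \<mu>\<^sup>2"
    by (rule *(1))
  show "1/2 * ((2*\<mu> - 1) * (y x - x) / (x * (x - 1)) + (2 * Afun y x + y x * (y x - 1)) / (x * (x - 1)) / (y x - 1) - 1/(x - 1))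
         * (x - 1) * ((Omega1 \<mu> y B x)\<^sup>2 + (Omega3 \<mu> y B x)\<^sup>2)
       = Omega1 \<mu> y B x * (Omega2 \<mu> y B x * Omega3 \<mu> y B x - \<mu> * Omega1 \<mu> y B x)"
    by (rule *(2))
qed

text \<open>The frame equation restricted to the x-direction: with u_1 and u_2 fixed one has du_3 =
  H dx, and H times the rotation coefficients depends on x alone. The condition on g is the one that
  its own column imposes.\<close>

lemma scaled_E_has_field_derivative:
  assumes P: "PVI_solution_on \<mu> X y" and x: "x \<in> X" and adm: "admissible_branches \<mu> k0 y X L B"
    and mu: "\<mu> \<noteq> 0" and E21: "E \<mu> y B x $ 2 $ 1 \<noteq> 0"
    and g: "(g has_field_derivative
       1/2 * ((2*\<mu> - 1) * (y x - x) / (x * (x - 1)) + (2 * Afun y x + y x * (y x - 1)) / (x * (x - 1)) / (y x - 1) - 1/(x - 1)) * g x) (at x)"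
    and g0: "g x \<noteq> 0"
  shows "((\<lambda>x. scaled_E \<mu> y B g x $ 1 $ \<alpha>) has_field_derivative Omega2 \<mu> y B x * scaled_E \<mu> y B g x $ 3 $ \<alpha> / x) (at x)" (is "?P1 \<alpha>")
    and "((\<lambda>x. scaled_E \<mu> y B g x $ 2 $ \<alpha>) has_field_derivative - Omega1 \<mu> y B x * scaled_E \<mu> y B g x $ 3 $ \<alpha> / (x - 1)) (at x)" (is "?P2 \<alpha>")
    and "((\<lambda>x. scaled_E \<mu> y B g x $ 3 $ \<alpha>) has_field_derivative
          - Omega2 \<mu> y B x * scaled_E \<mu> y B g x $ 1 $ \<alpha> / x + Omega1 \<mu> y B x * scaled_E \<mu> y B g x $ 2 $ \<alpha> / (x - 1)) (at x)" (is "?P3 \<alpha>")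
proof -
  define l where "l = 1/2 * ((2*\<mu> - 1) * (y x - x) / (x * (x - 1)) + (2 * Afun y x + y x * (y x - 1)) / (x * (x - 1)) / (y x - 1) - 1/(x - 1))"
  have dg: "(g has_field_derivative l * g x) (at x)" using g unfolding l_def .
  have nz: "x \<noteq> 0" "x \<noteq> 1" using P x unfolding PVI_solution_on_def by auto
  define O1 O2 O3 where O: "O1 = Omega1 \<mu> y B x" "O2 = Omega2 \<mu> y B x" "O3 = Omega3 \<mu> y B x"
  define d1 d2 d3 where d: "d1 = O2 * O3 / x" "d2 = - O1 * O3 / (x-1)" "d3 = O1 * O2 / (x * (x - 1))"
  define D where "D = O1\<^sup>2 + O3\<^sup>2"
  note dO = Omega_has_field_derivative[OF P x adm, folded O, folded d]
  have D: "O1\<^sup>2 + O3\<^sup>2 \<noteq> 0" using E21 unfolding E_entries(2) O by (metis div_0 minus_zero)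
  note alg = E_deriv_identities[OF nz mu D _ _ d, of l, folded D_def]
  have sum: "O1\<^sup>2 + O2\<^sup>2 + O3\<^sup>2 = - \<mu>\<^sup>2" and l: "l * (x - 1) * D = O1 * (O2 * O3 - \<mu> * O1)"
    using Omega_identities[OF P x adm] unfolding O l_def D_def by auto
  note alg = alg[OF sum l]
  have D0: "D \<noteq> 0" using D unfolding D_def .
  have dD: "((\<lambda>x. (Omega1 \<mu> y B x)\<^sup>2 + (Omega3 \<mu> y B x)\<^sup>2) has_field_derivative 2 * O1 * d1 + 2 * O3 * d3) (at x)"
    unfolding power2_eq_square O
    by (rule DERIV_cong[OF DERIV_add[OF DERIV_mult[OF dO(1) dO(1)] DERIV_mult[OF dO(3) dO(3)]]]) (simp add: O)
  have over: "((\<lambda>x. f x / g x) has_field_derivative (f' - l * f x) / g x) (at x)" if "(f has_field_derivative f') (at x)" for f f'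
    by (rule DERIV_cong[OF DERIV_divide[OF that dg g0]]) (use g0 in \<open>simp add: field_simps\<close>)
  have times: "((\<lambda>x. f x * g x) has_field_derivative (f' + l * f x) * g x) (at x)" if "(f has_field_derivative f') (at x)" for f f'
    by (rule DERIV_cong[OF DERIV_mult[OF that dg]]) (simp add: algebra_simps)
  have quot: "((\<lambda>x. f x / ((Omega1 \<mu> y B x)\<^sup>2 + (Omega3 \<mu> y B x)\<^sup>2)) has_field_derivative (f' * D - f x * (2 * O1 * d1 + 2 * O3 * d3)) / D\<^sup>2) (at x)"
    if "(f has_field_derivative f') (at x)" for f f'
    using DERIV_divide[OF that dD] D0 unfolding O[symmetric] D_def[symmetric] power2_eq_square[of D] by simp
  have e11: "((\<lambda>x. E \<mu> y B x $ 1 $ 1) has_field_derivative (d1 * O2 + O1 * d2 - \<mu> * d3) / (2 * \<mu>\<^sup>2)) (at x)"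
    unfolding E_entries
    by (rule DERIV_cong[OF DERIV_cdivide[OF DERIV_diff[OF DERIV_mult[OF dO(1) dO(2)] DERIV_cmult[OF dO(3)]]]]) (simp add: O)
  have e21: "((\<lambda>x. E \<mu> y B x $ 2 $ 1) has_field_derivative - (2 * O1 * d1 + 2 * O3 * d3) / (2 * \<mu>\<^sup>2)) (at x)"
    unfolding E_entries by (rule DERIV_cdivide[OF DERIV_minus[OF dD]])
  have e31: "((\<lambda>x. E \<mu> y B x $ 3 $ 1) has_field_derivative (d2 * O3 + O2 * d3 + \<mu> * d1) / (2 * \<mu>\<^sup>2)) (at x)"
    unfolding E_entries
    by (rule DERIV_cong[OF DERIV_cdivide[OF DERIV_add[OF DERIV_mult[OF dO(2) dO(3)] DERIV_cmult[OF dO(1)]]]]) (simp add: O)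
  have e13: "((\<lambda>x. E \<mu> y B x $ 1 $ 3) has_field_derivative (- (d1 * O2 + O1 * d2 + \<mu> * d3) * D + (O1 * O2 + \<mu> * O3) * (2 * O1 * d1 + 2 * O3 * d3)) / D\<^sup>2) (at x)"
    unfolding E_entries
    by (rule DERIV_cong[OF quot[OF DERIV_minus[OF DERIV_add[OF DERIV_mult[OF dO(1) dO(2)] DERIV_cmult[OF dO(3)]]]]]) (simp add: O algebra_simps)
  have e33: "((\<lambda>x. E \<mu> y B x $ 3 $ 3) has_field_derivative (- (d2 * O3 + O2 * d3 - \<mu> * d1) * D + (O2 * O3 - \<mu> * O1) * (2 * O1 * d1 + 2 * O3 * d3)) / D\<^sup>2) (at x)"
    unfolding E_entries
    by (rule DERIV_cong[OF quot[OF DERIV_minus[OF DERIV_diff[OF DERIV_mult[OF dO(2) dO(3)] DERIV_cmult[OF dO(1)]]]]]) (simp add: O algebra_simps)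
  note entries = E_entries[of \<mu> y B x, folded O, folded D_def]
  have f11: "?P1 1"
    unfolding scaled_E_entries
    by (rule DERIV_cong[OF over[OF e11]]) (unfold entries O[symmetric], use alg(1) mu in \<open>simp add: diff_divide_distrib[symmetric]\<close>)
  have e21': "- (2 * O1 * d1 + 2 * O3 * d3) / (2 * \<mu>\<^sup>2) - l * (- D / (2 * \<mu>\<^sup>2)) = - O1 * (O2 * O3 + \<mu> * O1) / (x - 1) / (2 * \<mu>\<^sup>2)"
    unfolding alg(2)[symmetric] by (simp add: diff_divide_distrib add_divide_distrib)
  have f21: "?P2 1"
    unfolding scaled_E_entries
    by (rule DERIV_cong[OF over[OF e21]]) (unfold entries O[symmetric] e21', simp)
  have f31: "?P3 1"
    unfolding scaled_E_entries
    by (rule DERIV_cong[OF over[OF e31]]) (unfold entries O[symmetric], use alg(3) mu in \<open>simp add: diff_divide_distrib[symmetric]\<close>, simp add: diff_divide_distrib mult_ac)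
  have neg: "l * (- N / D) = - (l * N / D)" for N by simp
  have f13: "?P1 3"
    unfolding scaled_E_entries
    by (rule DERIV_cong[OF times[OF e13]]) (unfold entries O[symmetric] neg add_uminus_conv_diff alg(4), simp only: minus_divide_left[symmetric] times_divide_eq_left times_divide_eq_right mult_minus_left mult_minus_right mult.assoc divide_divide_eq_left mult.commute[of D])
  have f23: "?P2 3"
    unfolding scaled_E_entries
    by (simp only: E_entries(8) mult_1_left, rule DERIV_cong[OF dg]) (unfold entries O[symmetric] alg(5), simp only: minus_divide_left[symmetric] times_divide_eq_left times_divide_eq_right mult_minus_left mult_minus_right mult.assoc divide_divide_eq_left minus_minus mult.commute[of D])
  have f33: "?P3 3"
    unfolding scaled_E_entries
    by (rule DERIV_cong[OF times[OF e33]]) (unfold entries O[symmetric] neg add_uminus_conv_diff alg(6), simp add: algebra_simps)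
  have f2: "?P1 2" "?P2 2" "?P3 2"
    unfolding scaled_E_entries E_entries
    by (rule DERIV_cong[OF DERIV_cdivide[OF dO(1)]] DERIV_cong[OF DERIV_cdivide[OF dO(2)]] DERIV_cong[OF DERIV_cdivide[OF dO(3)]];
        unfold O[symmetric] d; use nz mu in \<open>simp add: field_simps\<close>)+
  show "?P1 \<alpha>" "?P2 \<alpha>" "?P3 \<alpha>"
    using f11 f21 f31 f2 f13 f23 f33 exhaust_3[of \<alpha>] by blast+
qed

text \<open>V acts as the cross product with the vector of the \<Omega>, so that vector spans the
  kernel, and 1/(\<i>\<mu>) normalises it. The form is bilinear rather than Hermitian, and skewness
  makes the eigencolumns for \<mu> and -\<mu> isotropic. All entries are checked as rational
  identities after expressing \<Omega>1^2 and \<Omega>2^2 through the common denominator D.\<close>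

lemma E_algebra:
  assumes P: "PVI_solution_on \<mu> X y" and x: "x \<in> X" and adm: "admissible_branches \<mu> k0 y X L B"
    and mu: "\<mu> \<noteq> 0" and E21: "E \<mu> y B x $ 2 $ 1 \<noteq> 0"
  shows "(\<Sum>j\<in>UNIV. E \<mu> y B x $ j $ \<alpha> * E \<mu> y B x $ j $ \<beta>) = eta $ \<alpha> $ \<beta>"
    and "- Omega3 \<mu> y B x * E \<mu> y B x $ 2 $ \<alpha> + Omega2 \<mu> y B x * E \<mu> y B x $ 3 $ \<alpha> = vector [\<mu>, 0, - \<mu>] $ \<alpha> * E \<mu> y B x $ 1 $ \<alpha>" (is "?A1 \<alpha>")
    and "Omega3 \<mu> y B x * E \<mu> y B x $ 1 $ \<alpha> - Omega1 \<mu> y B x * E \<mu> y B x $ 3 $ \<alpha> = vector [\<mu>, 0, - \<mu>] $ \<alpha> * E \<mu> y B x $ 2 $ \<alpha>" (is "?A2 \<alpha>")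
    and "- Omega2 \<mu> y B x * E \<mu> y B x $ 1 $ \<alpha> + Omega1 \<mu> y B x * E \<mu> y B x $ 2 $ \<alpha> = vector [\<mu>, 0, - \<mu>] $ \<alpha> * E \<mu> y B x $ 3 $ \<alpha>" (is "?A3 \<alpha>")
proof -
  define O1 O2 O3 where O: "O1 = Omega1 \<mu> y B x" "O2 = Omega2 \<mu> y B x" "O3 = Omega3 \<mu> y B x"
  define D where "D = O1\<^sup>2 + O3\<^sup>2"
  have D: "D \<noteq> 0" using E21 unfolding E_entries(2) O D_def by (metis div_0 minus_zero)
  have sum: "O2\<^sup>2 = - \<mu>\<^sup>2 - D"
    using Omega_identities(1)[OF P x adm] unfolding O D_def by (simp add: algebra_simps)
  have O1: "O1\<^sup>2 = D - O3\<^sup>2" by (simp add: D_def)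
  note entries = E_entries[of \<mu> y B x, folded O, folded D_def]
  have eig: "?A1 1" "?A1 2" "?A1 3" "?A2 1" "?A2 2" "?A2 3" "?A3 1" "?A3 2" "?A3 3"
    unfolding entries O[symmetric] vector_3 using D mu
    by (simp_all add: divide_simps) (use sum O1 in algebra)+
  show "?A1 \<alpha>" "?A2 \<alpha>" "?A3 \<alpha>"
    using eig exhaust_3[of \<alpha>] by blast+
  have e: "eta $ 1 $ 1 = 0" "eta $ 1 $ 2 = 0" "eta $ 1 $ 3 = 1" "eta $ 2 $ 1 = 0" "eta $ 2 $ 2 = 1" "eta $ 2 $ 3 = 0"
     "eta $ 3 $ 1 = 1" "eta $ 3 $ 2 = 0" "eta $ 3 $ 3 = 0"
    by (simp_all add: eta_def)
  have ii: "\<i> * \<i> = -1" by simp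
  let ?B = "\<lambda>\<alpha> \<beta>. (\<Sum>j\<in>UNIV. E \<mu> y B x $ j $ \<alpha> * E \<mu> y B x $ j $ \<beta>) = eta $ \<alpha> $ \<beta>"
  have "?B 1 1" "?B 1 2" "?B 1 3" "?B 2 1" "?B 2 2" "?B 2 3" "?B 3 1" "?B 3 2" "?B 3 3"
    unfolding sum_3 entries e using D mu
    by (simp_all add: divide_simps) (use sum O1 ii in algebra)+
  then show "?B \<alpha> \<beta>"
    using exhaust_3[of \<alpha>] exhaust_3[of \<beta>] by blast
qed

section \<open>The frame of a Painleve VI transcendent\<close>

text \<open>The x-part of f^2, that is f^2 with its power of H removed. It is free of square roots
  and so can be differentiated directly.\<close>

definition ffun_square :: "complex \<Rightarrow> complex \<Rightarrow> (complex \<Rightarrow> complex) \<Rightarrow> branches \<Rightarrow> complex \<Rightarrow> complex" where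
  "ffun_square \<mu> k0 y B x = k0 * exp ((2 * \<mu> - 1) * prim B x) * (y x - 1) / (x - 1)"

lemma ffun_square:
  assumes adm: "admissible_branches \<mu> k0 y X L B" and x: "x \<in> X" and H: "H \<in> L"
  shows "(ffun B x H * H_power B H \<mu>)\<^sup>2 = ffun_square \<mu> k0 y B x"
proof -
  have sq: "(sqrt_y1 B x)\<^sup>2 = y x - 1" "(sqrt_1x B x)\<^sup>2 = 1 - x" "(sqrt_H B H)\<^sup>2 = H"
      "(sqrt_k B (x, H))\<^sup>2 = kfun \<mu> k0 B x H" "exp (log_H B H) = H"
    using adm x H unfolding admissible_branches_def sqrt_branch_def by auto
  have "H_power B H \<mu> ^ 2 = H_power B H (2 * \<mu> - 1) * H"
    unfolding H_power_def by (subst sq(5)[symmetric]) (simp add: exp_add[symmetric] power2_eq_square algebra_simps)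
  moreover have "H_power B H (2 * \<mu> - 1) \<noteq> 0" by (simp add: H_power_def)
  moreover have "H \<noteq> 0" using sq(5) by (metis exp_not_eq_zero)
  \<comment> \<open>The division by \<i> in \<open>ffun\<close> turns the root of 1 - x into one of
    x - 1; squaring produces this sign.\<close>
  moreover have "- (1 - x) = x - 1" by simp
  ultimately show ?thesis
    unfolding ffun_def ffun_square_def power_mult_distrib power_divide sq kfun_def
    by (simp add: minus_divide_right)
qed

lemma ffun_square_has_field_derivative:
  assumes P: "PVI_solution_on \<mu> X y" and adm: "admissible_branches \<mu> k0 y X L B" and x: "x \<in> X"
  shows "(ffun_square \<mu> k0 y B has_field_derivative ((2*\<mu> - 1) * (y x - x) / (x * (x - 1))
     + (2 * Afun y x + y x * (y x - 1)) / (x * (x - 1)) / (y x - 1) - 1/(x - 1)) * ffun_square \<mu> k0 y B x) (at x)"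
proof -
  have nz: "x \<noteq> 0" "x - 1 \<noteq> 0" "y x - 1 \<noteq> 0" using P x unfolding PVI_solution_on_def by auto
  have dp: "(prim B has_field_derivative (y x - x) / (x * (x - 1))) (at x)"
    using adm x unfolding admissible_branches_def by blast
  define d where "d = (2 * Afun y x + y x * (y x - 1)) / (x * (x - 1))"
  have dy: "(y has_field_derivative d) (at x)" using Afun_has_field_derivative(1)[OF P x] unfolding d_def .
  have e: "((\<lambda>x. k0 * exp ((2 * \<mu> - 1) * prim B x)) has_field_derivative
        (k0 * exp ((2 * \<mu> - 1) * prim B x)) * ((2 * \<mu> - 1) * ((y x - x) / (x * (x - 1))))) (at x)"
    by (rule DERIV_cong[OF DERIV_cmult[OF DERIV_chain2[OF DERIV_exp DERIV_cmult[OF dp]]]]) simp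
  have n: "((\<lambda>x. y x - 1) has_field_derivative (y x - 1) * (d / (y x - 1))) (at x)"
    by (rule DERIV_cong[OF DERIV_diff[OF dy DERIV_const]]) (use nz in simp)
  have m: "((\<lambda>x. x - 1) has_field_derivative (x - 1) * (1 / (x - 1))) (at x)"
    by (rule DERIV_cong[OF DERIV_diff[OF DERIV_ident DERIV_const]]) (use nz in simp)
  from quotient_log_deriv[where k = 1, OF e n m nz(2)] show ?thesis
    unfolding ffun_square_def[abs_def] d_def[symmetric] by (simp add: mult_ac)
qed

lemma ratio_has_derivative:
  assumes "u $ 1 \<noteq> u $ 2"
  shows "(ratio has_derivative (\<lambda>v. ((v $ 3 - v $ 1) - ratio u * (v $ 2 - v $ 1)) / diff21 u)) (at u)"
    and "(diff21 has_derivative (\<lambda>v. v $ 2 - v $ 1)) (at u)"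
proof -
  have nth: "((\<lambda>u. u $ j) has_derivative (\<lambda>v. v $ j)) (at u)" for j :: 3 and u :: "complex ^ 3"
    by (rule bounded_linear_imp_has_derivative[OF bounded_linear_vec_nth])
  have d: "((\<lambda>u. u $ i - u $ j) has_derivative (\<lambda>v. v $ i - v $ j)) (at u)" for i j :: 3
    by (intro has_derivative_diff nth)
  then show "(diff21 has_derivative (\<lambda>v. v $ 2 - v $ 1)) (at u)" unfolding diff21_def[abs_def] .
  have nz: "u $ 2 - u $ 1 \<noteq> 0" using assms by simp
  show "(ratio has_derivative (\<lambda>v. ((v $ 3 - v $ 1) - ratio u * (v $ 2 - v $ 1)) / diff21 u)) (at u)"
    unfolding ratio_def[abs_def] diff21_def
    by (rule has_derivative_eq_rhs[OF has_derivative_divide'[OF d d nz]])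
      (use nz in \<open>simp add: fun_eq_iff divide_simps\<close>)
qed

text \<open>Entry jk is V_jk / (u_k - u_j), the differences being H, x H and (x - 1) H. Both
  numerator and denominator are skew, hence the symmetry.\<close>

definition rotation :: "complex \<Rightarrow> (complex \<Rightarrow> complex) \<Rightarrow> branches \<Rightarrow> complex ^ 3 \<Rightarrow> complex ^ 3 ^ 3" where
  "rotation \<mu> y B u = (let x = ratio u; H = diff21 u;
       \<gamma>12 = - Omega3 \<mu> y B x / H; \<gamma>13 = Omega2 \<mu> y B x / (x * H); \<gamma>23 = - Omega1 \<mu> y B x / ((x - 1) * H) in
     vector [vector [0, \<gamma>12, \<gamma>13], vector [\<gamma>12, 0, \<gamma>23], vector [\<gamma>13, \<gamma>23, 0]])"

definition frame :: "complex \<Rightarrow> (complex \<Rightarrow> complex) \<Rightarrow> branches \<Rightarrow> (complex \<Rightarrow> complex) \<Rightarrow> complex ^ 3 \<Rightarrow> complex ^ 3 ^ 3" where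
  "frame \<mu> y B g u = (\<chi> j \<alpha>. scaled_E \<mu> y B g (ratio u) $ j $ \<alpha> * H_power B (diff21 u) (weight \<mu> \<alpha>))"

text \<open>With w2 = du_2 - du_1 and w3 = du_3 - du_1, the term w2/h is dH/H and (w3 - x w2)/h is
  dx. The eigenvector equation supplies the coefficient of the former, the equations in x that of
  the latter.\<close>

lemma frame_deriv_identities:
  fixes x h m p1 p2 p3 O1 O2 O3 w2 w3 :: complex
  assumes nz: "x \<noteq> 0" "x \<noteq> 1" "h \<noteq> 0"
    and eig: "- O3 * p2 + O2 * p3 = m * p1" "O3 * p1 - O1 * p3 = m * p2" "- O2 * p1 + O1 * p2 = m * p3"
  shows "- O3 / h * p2 * w2 + O2 / (x * h) * p3 * w3 = m * p1 * (w2 / h) + O2 * p3 / x * ((w3 - x * w2) / h)"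
    and "- O3 / h * p1 * (- w2) + - O1 / ((x - 1) * h) * p3 * (w3 - w2)
        = m * p2 * (w2 / h) + - O1 * p3 / (x - 1) * ((w3 - x * w2) / h)"
    and "O2 / (x * h) * p1 * (- w3) + - O1 / ((x - 1) * h) * p2 * (w2 - w3)
        = m * p3 * (w2 / h) + (- O2 * p1 / x + O1 * p2 / (x - 1)) * ((w3 - x * w2) / h)"
proof -
  have nz': "x - 1 \<noteq> 0" using nz by simp
  show "- O3 / h * p2 * w2 + O2 / (x * h) * p3 * w3 = m * p1 * (w2 / h) + O2 * p3 / x * ((w3 - x * w2) / h)"
    unfolding eig[symmetric] using nz nz' by (simp add: divide_simps) (simp add: algebra_simps)
  show "- O3 / h * p1 * (- w2) + - O1 / ((x - 1) * h) * p3 * (w3 - w2)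
        = m * p2 * (w2 / h) + - O1 * p3 / (x - 1) * ((w3 - x * w2) / h)"
    unfolding eig[symmetric] using nz nz' by (simp add: divide_simps) (simp add: algebra_simps)
  show "O2 / (x * h) * p1 * (- w3) + - O1 / ((x - 1) * h) * p2 * (w2 - w3)
        = m * p3 * (w2 / h) + (- O2 * p1 / x + O1 * p2 / (x - 1)) * ((w3 - x * w2) / h)"
    unfolding eig[symmetric] using nz nz' by (simp add: divide_simps) (simp add: algebra_simps)
qed

lemma scaled_E_algebra:
  assumes P: "PVI_solution_on \<mu> X y" and x: "x \<in> X" and adm: "admissible_branches \<mu> k0 y X L B"
    and mu: "\<mu> \<noteq> 0" and E21: "E \<mu> y B x $ 2 $ 1 \<noteq> 0" and g: "g x \<noteq> 0"
  shows "(\<Sum>j\<in>UNIV. scaled_E \<mu> y B g x $ j $ \<alpha> * scaled_E \<mu> y B g x $ j $ \<beta>) = eta $ \<alpha> $ \<beta>" (is ?A)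
    and "- Omega3 \<mu> y B x * scaled_E \<mu> y B g x $ 2 $ \<alpha> + Omega2 \<mu> y B x * scaled_E \<mu> y B g x $ 3 $ \<alpha> = weight \<mu> \<alpha> * scaled_E \<mu> y B g x $ 1 $ \<alpha>"
    and "Omega3 \<mu> y B x * scaled_E \<mu> y B g x $ 1 $ \<alpha> - Omega1 \<mu> y B x * scaled_E \<mu> y B g x $ 3 $ \<alpha> = weight \<mu> \<alpha> * scaled_E \<mu> y B g x $ 2 $ \<alpha>"
    and "- Omega2 \<mu> y B x * scaled_E \<mu> y B g x $ 1 $ \<alpha> + Omega1 \<mu> y B x * scaled_E \<mu> y B g x $ 2 $ \<alpha> = weight \<mu> \<alpha> * scaled_E \<mu> y B g x $ 3 $ \<alpha>"
proof -
  note alg = E_algebra[OF P x adm mu E21]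
  define s where "s = (vector [inverse (g x), 1, g x] :: complex ^ 3)"
  have e: "scaled_E \<mu> y B g x $ j $ \<alpha> = E \<mu> y B x $ j $ \<alpha> * s $ \<alpha>" for j \<alpha>
    by (simp add: scaled_E_def s_def)
  have "(\<Sum>j\<in>UNIV. scaled_E \<mu> y B g x $ j $ \<alpha> * scaled_E \<mu> y B g x $ j $ \<beta>) = eta $ \<alpha> $ \<beta> * (s $ \<alpha> * s $ \<beta>)"
    unfolding alg(1)[symmetric] e sum_distrib_right by (simp add: mult_ac)
  also have "\<dots> = eta $ \<alpha> $ \<beta>"
    using exhaust_3[of \<alpha>] exhaust_3[of \<beta>] g by (elim disjE) (simp_all add: s_def)
  finally show ?A .
  note alg' = alg(2-4)[of \<alpha>, folded weight_def]
  show "- Omega3 \<mu> y B x * scaled_E \<mu> y B g x $ 2 $ \<alpha> + Omega2 \<mu> y B x * scaled_E \<mu> y B g x $ 3 $ \<alpha> = weight \<mu> \<alpha> * scaled_E \<mu> y B g x $ 1 $ \<alpha>"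
    unfolding e mult.assoc[symmetric] alg'[symmetric] by (simp add: algebra_simps)
  show "Omega3 \<mu> y B x * scaled_E \<mu> y B g x $ 1 $ \<alpha> - Omega1 \<mu> y B x * scaled_E \<mu> y B g x $ 3 $ \<alpha> = weight \<mu> \<alpha> * scaled_E \<mu> y B g x $ 2 $ \<alpha>"
    unfolding e mult.assoc[symmetric] alg'[symmetric] by (simp add: algebra_simps)
  show "- Omega2 \<mu> y B x * scaled_E \<mu> y B g x $ 1 $ \<alpha> + Omega1 \<mu> y B x * scaled_E \<mu> y B g x $ 2 $ \<alpha> = weight \<mu> \<alpha> * scaled_E \<mu> y B g x $ 3 $ \<alpha>"
    unfolding e mult.assoc[symmetric] alg'[symmetric] by (simp add: algebra_simps)
qed

lemma ratio_diff21:
  assumes "u $ 1 \<noteq> u $ 2"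
  shows "diff21 u \<noteq> 0" "u $ 2 = u $ 1 + diff21 u" "u $ 3 = u $ 1 + ratio u * diff21 u"
  using assms by (simp_all add: ratio_def diff21_def)

section \<open>Powers of H and the local form of f\<close>

lemma H_power_add: "H_power B H (r + s) = H_power B H r * H_power B H s"
  by (simp add: H_power_def distrib_right exp_add)

lemma H_power_zero [simp]: "H_power B H 0 = 1"
  by (simp add: H_power_def)

lemma H_power_nonzero [simp]: "H_power B H r \<noteq> 0"
  by (simp add: H_power_def)

lemma H_power_minus: "H_power B H (- r) = inverse (H_power B H r)"
  by (simp add: H_power_def exp_minus)

lemma H_power_one:
  assumes "admissible_branches \<mu> k0 y X L B" "H \<in> L"
  shows "H_power B H 1 = H"
  using assms by (simp add: H_power_def admissible_branches_def)

text \<open>The splitting \<open>f = g(x) H\<^sup>-\<^sup>\<mu>\<close> is only local: nothing connects the components of \<open>X \<times> L\<close>, so the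
  chosen root of \<open>k\<close> may change sign between them.\<close>

lemma ffun_local_product:
  assumes P: "PVI_solution_on \<mu> X y" and adm: "admissible_branches \<mu> k0 y X L B"
    and k0: "k0 \<noteq> 0" and L: "open L"
    and u0: "u0 $ 1 \<noteq> u0 $ 2" "u0 $ 2 \<noteq> u0 $ 3" "u0 $ 1 \<noteq> u0 $ 3" "ratio u0 \<in> X" "diff21 u0 \<in> L"
    and mu: "\<mu> \<noteq> 0"
    and E0: "E \<mu> y B (ratio u0) $ 1 $ 1 * E \<mu> y B (ratio u0) $ 2 $ 1 * E \<mu> y B (ratio u0) $ 3 $ 1 \<noteq> 0"
  obtains N g where "open N" "u0 \<in> N"
    "\<And>u. u \<in> N \<Longrightarrow> u $ 1 \<noteq> u $ 2 \<and> u $ 2 \<noteq> u $ 3 \<and> u $ 1 \<noteq> u $ 3 \<and> ratio u \<in> X \<and> diff21 u \<in> L"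
    "\<And>u j. u \<in> N \<Longrightarrow> E \<mu> y B (ratio u) $ j $ 1 \<noteq> 0"
    "\<And>u. u \<in> N \<Longrightarrow> g (ratio u) \<noteq> 0"
    "\<And>u. u \<in> N \<Longrightarrow> ffun B (ratio u) (diff21 u) = g (ratio u) * H_power B (diff21 u) (- \<mu>)"
    "\<And>u. u \<in> N \<Longrightarrow> (g has_field_derivative
       1/2 * ((2*\<mu> - 1) * (y (ratio u) - ratio u) / (ratio u * (ratio u - 1))
          + (2 * Afun y (ratio u) + y (ratio u) * (y (ratio u) - 1)) / (ratio u * (ratio u - 1)) / (y (ratio u) - 1)
          - 1/(ratio u - 1)) * g (ratio u)) (at (ratio u))"
proof -
  let ?q = "ffun_square \<mu> k0 y B"
  let ?h = "\<lambda>u. ffun B (ratio u) (diff21 u) * H_power B (diff21 u) \<mu>"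
  have opX: "open X" and nz: "\<And>x. x \<in> X \<Longrightarrow> x \<noteq> 0 \<and> x \<noteq> 1 \<and> y x \<noteq> 1"
    using P unfolding PVI_solution_on_def by auto
  have q0: "?q x \<noteq> 0" if "x \<in> X" for x
    using nz[OF that] k0 by (simp add: ffun_square_def)
  define V0 where "V0 = {u :: complex ^ 3. u $ 1 \<noteq> u $ 2 \<and> u $ 2 \<noteq> u $ 3 \<and> u $ 1 \<noteq> u $ 3}"
  have opV0: "open V0"
    unfolding V0_def by (intro open_Collect_conj open_Collect_neq continuous_intros)
  have cr: "continuous_on V0 ratio" and cd: "continuous_on V0 diff21"
    unfolding ratio_def[abs_def] diff21_def[abs_def] V0_def by (auto intro!: continuous_intros)
  define V where "V = (V0 \<inter> ratio -` X) \<inter> (V0 \<inter> diff21 -` L)"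
  have opV: "open V"
    unfolding V_def by (intro open_Int continuous_open_preimage cr cd opV0 opX L)
  have u0V: "u0 \<in> V" using u0 by (simp add: V_def V0_def)
  have VX: "u \<in> V \<Longrightarrow> ratio u \<in> X" and VL: "u \<in> V \<Longrightarrow> diff21 u \<in> L" for u
    by (auto simp: V_def)
  have cr: "continuous_on V ratio" and cd: "continuous_on V diff21"
    using cr cd by (auto intro: continuous_on_subset simp: V_def)
  have br: "continuous_on X (sqrt_1x B)" "continuous_on X (sqrt_y1 B)" "continuous_on L (log_H B)" "continuous_on L (sqrt_H B)"
      "continuous_on (X \<times> L) (sqrt_k B)"
      "\<And>x. x \<in> X \<Longrightarrow> (sqrt_1x B x)\<^sup>2 = 1 - x" "\<And>H. H \<in> L \<Longrightarrow> (sqrt_H B H)\<^sup>2 = H" "\<And>H. H \<in> L \<Longrightarrow> exp (log_H B H) = H"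
    using adm unfolding admissible_branches_def sqrt_branch_def by auto
  have nz1: "sqrt_1x B (ratio u) \<noteq> 0" if "u \<in> V" for u
    using br(6)[OF VX[OF that]] nz[OF VX[OF that]] by auto
  have nz2: "sqrt_H B (diff21 u) \<noteq> 0" if "u \<in> V" for u
    using br(7,8)[OF VL[OF that]] by (metis exp_not_eq_zero zero_power2)
  have "continuous_on V ?h"
    unfolding ffun_def H_power_def
    by (intro continuous_intros continuous_on_compose2[OF br(1) cr] continuous_on_compose2[OF br(2) cr]
        continuous_on_compose2[OF br(3) cd] continuous_on_compose2[OF br(4) cd] continuous_on_compose2[OF br(5)] cr cd)
      (auto simp: nz1 nz2 VX VL)
  \<comment> \<open>f H^\<mu> is a continuous root of a function of the ratio alone. Near
    \<open>u0\<close> it is therefore a constant times a principal root of that function, which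
    defines g as a function of one variable.\<close>
  then have "sqrt_branch V (\<lambda>u. ?q (ratio u)) ?h"
    unfolding sqrt_branch_def using ffun_square[OF adm VX VL] by blast
  note ev = sqrt_branch_eq_csqrt[OF opV this u0V q0[OF VX[OF u0V]]]
  define g where "g x = ?h u0 * csqrt (?q x / ?q (ratio u0))" for x
  have h0: "?h u0 \<noteq> 0"
    using ffun_square[OF adm VX[OF u0V] VL[OF u0V]] q0[OF VX[OF u0V]] by auto
  have cont_ratio: "isCont ratio u0" using cr opV u0V by (simp add: continuous_on_eq_continuous_at)
  have dq: "(?q has_field_derivative ((2*\<mu> - 1) * (y x - x) / (x * (x - 1))
     + (2 * Afun y x + y x * (y x - 1)) / (x * (x - 1)) / (y x - 1) - 1/(x - 1)) * ?q x) (at x)" if "x \<in> X" for x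
    by (rule ffun_square_has_field_derivative[OF P adm that])
  have "isCont ?q (ratio u0)" using dq[OF u0(4)] by (rule DERIV_isCont)
  then have "isCont (\<lambda>u. ?q (ratio u) / ?q (ratio u0)) u0"
    using q0[OF u0(4)] by (intro continuous_intros isCont_o2[OF cont_ratio]) auto
  then have "((\<lambda>u. ?q (ratio u) / ?q (ratio u0)) \<longlongrightarrow> ?q (ratio u0) / ?q (ratio u0)) (nhds u0)"
    by (rule isCont_tendsto_nhds)
  from tendsto_Re[OF this] have "((\<lambda>u. Re (?q (ratio u) / ?q (ratio u0))) \<longlongrightarrow> 1) (nhds u0)"
    using q0[OF u0(4)] by simp
  \<comment> \<open>A positive real part keeps the quotient off the cut of the principal root, so g
    is differentiable at these ratios.\<close>
  then have ev2: "eventually (\<lambda>u. 0 < Re (?q (ratio u) / ?q (ratio u0))) (nhds u0)"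
    by (rule order_tendstoD) simp
  have cO: "isCont (Omega1 \<mu> y B) (ratio u0)" "isCont (Omega2 \<mu> y B) (ratio u0)" "isCont (Omega3 \<mu> y B) (ratio u0)"
    using Omega_has_field_derivative[OF P u0(4) adm] by (auto intro: DERIV_isCont)
  have "isCont (\<lambda>x. E \<mu> y B x $ 1 $ 1 * E \<mu> y B x $ 2 $ 1 * E \<mu> y B x $ 3 $ 1) (ratio u0)"
    unfolding E_entries using mu by (intro continuous_intros cO) auto
  then have "isCont (\<lambda>u. E \<mu> y B (ratio u) $ 1 $ 1 * E \<mu> y B (ratio u) $ 2 $ 1 * E \<mu> y B (ratio u) $ 3 $ 1) u0"
    by (rule isCont_o2[OF cont_ratio])
  then have ev3: "eventually (\<lambda>u. E \<mu> y B (ratio u) $ 1 $ 1 * E \<mu> y B (ratio u) $ 2 $ 1 * E \<mu> y B (ratio u) $ 3 $ 1 \<noteq> 0) (nhds u0)"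
    using E0 by (intro tendsto_imp_eventually_ne[OF isCont_tendsto_nhds])
  have "eventually (\<lambda>u. u \<in> V) (nhds u0)" using opV u0V by (rule eventually_nhds_in_open)
  with ev ev2 ev3 have "eventually (\<lambda>u. ?h u = ?h u0 * csqrt (?q (ratio u) / ?q (ratio u0)) \<and>
      0 < Re (?q (ratio u) / ?q (ratio u0)) \<and>
      E \<mu> y B (ratio u) $ 1 $ 1 * E \<mu> y B (ratio u) $ 2 $ 1 * E \<mu> y B (ratio u) $ 3 $ 1 \<noteq> 0 \<and> u \<in> V) (nhds u0)"
    by (intro eventually_conj)
  then obtain N where N: "open N" "u0 \<in> N"
    and NN: "\<And>u. u \<in> N \<Longrightarrow> ?h u = g (ratio u) \<and> 0 < Re (?q (ratio u) / ?q (ratio u0)) \<and>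
      E \<mu> y B (ratio u) $ 1 $ 1 * E \<mu> y B (ratio u) $ 2 $ 1 * E \<mu> y B (ratio u) $ 3 $ 1 \<noteq> 0 \<and> u \<in> V"
    unfolding eventually_nhds g_def by blast
  show thesis
  proof (rule that[OF N, of g])
    fix u assume u: "u \<in> N"
    have uV: "u \<in> V" using NN[OF u] by blast
    show "u $ 1 \<noteq> u $ 2 \<and> u $ 2 \<noteq> u $ 3 \<and> u $ 1 \<noteq> u $ 3 \<and> ratio u \<in> X \<and> diff21 u \<in> L"
      using uV by (auto simp: V_def V0_def)
    show "E \<mu> y B (ratio u) $ j $ 1 \<noteq> 0" for j
      using NN[OF u] exhaust_3[of j] by auto
    show "g (ratio u) \<noteq> 0"
      using h0 q0[OF VX[OF uV]] q0[OF u0(4)] by (simp add: g_def)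
    show "ffun B (ratio u) (diff21 u) = g (ratio u) * H_power B (diff21 u) (- \<mu>)"
      using NN[OF u] by (simp add: H_power_minus field_simps)
    let ?x = "ratio u"
    define l where "l = (2*\<mu> - 1) * (y ?x - ?x) / (?x * (?x - 1))
     + (2 * Afun y ?x + y ?x * (y ?x - 1)) / (?x * (?x - 1)) / (y ?x - 1) - 1/(?x - 1)"
    have w: "?q ?x / ?q (ratio u0) \<notin> \<real>\<^sub>\<le>\<^sub>0" using NN[OF u] by (auto simp: complex_nonpos_Reals_iff)
    have c: "csqrt (?q ?x / ?q (ratio u0)) * csqrt (?q ?x / ?q (ratio u0)) = ?q ?x / ?q (ratio u0)"
      by (simp flip: power2_eq_square)
    have "csqrt (?q ?x / ?q (ratio u0)) \<noteq> 0" using w by auto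
    then have e: "?h u0 * (l * ?q ?x / ?q (ratio u0) / (2 * csqrt (?q ?x / ?q (ratio u0)))) = 1/2 * l * g ?x"
      unfolding g_def using c by (simp add: field_simps)
    show "(g has_field_derivative 1/2 * ((2*\<mu> - 1) * (y ?x - ?x) / (?x * (?x - 1))
     + (2 * Afun y ?x + y ?x * (y ?x - 1)) / (?x * (?x - 1)) / (y ?x - 1) - 1/(?x - 1)) * g ?x) (at ?x)"
      using DERIV_cong[OF DERIV_cmult[OF has_field_derivative_csqrt'[OF DERIV_cdivide[OF dq[OF VX[OF uV], folded l_def]] w]] e]
      unfolding l_def[symmetric] g_def[abs_def] .
  qed
qed

text \<open>One expansion of the rotation sums into dH/H and dx, valid for every direction v, serves
  twice: v = u gives homogeneity, and arbitrary v is matched with the chain rule for the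
  derivative.\<close>

lemma egoroff_frame_of_PVI:
  assumes P: "PVI_solution_on \<mu> X y" and adm: "admissible_branches \<mu> k0 y X L B"
    and L: "open L" and N: "open N"
    and mu: "\<mu> \<noteq> 0" "\<mu> \<notin> {1/2, -1/2, 1, -1, 3/2, -3/2, 2, -2, 3, -3}"
    and dom: "\<And>u. u \<in> N \<Longrightarrow> u $ 1 \<noteq> u $ 2 \<and> ratio u \<in> X \<and> diff21 u \<in> L"
    and E1: "\<And>u j. u \<in> N \<Longrightarrow> E \<mu> y B (ratio u) $ j $ 1 \<noteq> 0"
    and g0: "\<And>u. u \<in> N \<Longrightarrow> g (ratio u) \<noteq> 0"
    and dg: "\<And>u. u \<in> N \<Longrightarrow> (g has_field_derivative
       1/2 * ((2*\<mu> - 1) * (y (ratio u) - ratio u) / (ratio u * (ratio u - 1))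
          + (2 * Afun y (ratio u) + y (ratio u) * (y (ratio u) - 1)) / (ratio u * (ratio u - 1)) / (y (ratio u) - 1)
          - 1/(ratio u - 1)) * g (ratio u)) (at (ratio u))"
  shows "egoroff_frame N (frame \<mu> y B g) (rotation \<mu> y B) \<mu>"
proof
  show "open N" "\<mu> \<notin> {1/2, -1/2, 1, -1, 3/2, -3/2, 2, -2, 3, -3}" by fact+
  fix u :: "complex ^ 3" assume u: "u \<in> N"
  define x where "x = ratio u"
  define h where "h = diff21 u"
  have xX: "x \<in> X" and hL: "h \<in> L" and u12: "u $ 1 \<noteq> u $ 2" using dom[OF u] by (auto simp: x_def h_def)
  have nz: "x \<noteq> 0" "x \<noteq> 1" using P xX unfolding PVI_solution_on_def by auto
  have h: "h \<noteq> 0" "u $ 2 = u $ 1 + h" "u $ 3 = u $ 1 + x * h"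
    using ratio_diff21[OF u12] by (auto simp: x_def h_def)
  have E21: "E \<mu> y B x $ 2 $ 1 \<noteq> 0" and gx: "g x \<noteq> 0" using E1[OF u] g0[OF u] by (auto simp: x_def)
  note salg = scaled_E_algebra[OF P xX adm mu(1) E21, of g, OF gx]
  note sder = scaled_E_has_field_derivative[OF P xX adm mu(1) E21 dg[OF u, folded x_def] gx]
  define \<phi> where "\<phi> = scaled_E \<mu> y B g x"
  define p where "p \<alpha> = H_power B h (weight \<mu> \<alpha>)" for \<alpha>
  have fr: "frame \<mu> y B g u $ j $ \<alpha> = \<phi> $ j $ \<alpha> * p \<alpha>" for j \<alpha>
    by (simp add: frame_def \<phi>_def p_def x_def h_def)
  have rot: "rotation \<mu> y B u = (let \<gamma>12 = - Omega3 \<mu> y B x / h; \<gamma>13 = Omega2 \<mu> y B x / (x * h); \<gamma>23 = - Omega1 \<mu> y B x / ((x - 1) * h) in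
     vector [vector [0, \<gamma>12, \<gamma>13], vector [\<gamma>12, 0, \<gamma>23], vector [\<gamma>13, \<gamma>23, 0]])"
    by (simp add: rotation_def x_def h_def Let_def)
  show "rotation \<mu> y B u $ j $ k = rotation \<mu> y B u $ k $ j" for j k
    using exhaust_3[of j] exhaust_3[of k] by (elim disjE) (simp_all add: rot Let_def)
  show "(\<Sum>j\<in>UNIV. frame \<mu> y B g u $ j $ \<alpha> * frame \<mu> y B g u $ j $ \<beta>) = eta $ \<alpha> $ \<beta>" for \<alpha> \<beta>
  proof -
    have "(\<Sum>j\<in>UNIV. frame \<mu> y B g u $ j $ \<alpha> * frame \<mu> y B g u $ j $ \<beta>) = eta $ \<alpha> $ \<beta> * (p \<alpha> * p \<beta>)"
      unfolding salg(1)[symmetric] fr \<phi>_def sum_distrib_right by (simp add: mult_ac)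
    also have "\<dots> = eta $ \<alpha> $ \<beta>"
      using exhaust_3[of \<alpha>] exhaust_3[of \<beta>]
      by (elim disjE) (simp_all add: p_def H_power_minus)
    finally show ?thesis .
  qed
  show "frame \<mu> y B g u $ j $ 1 \<noteq> 0" for j
    using E1[OF u, of j] gx by (simp add: fr \<phi>_def scaled_E_entries p_def x_def)
  have ralg: "(\<Sum>k\<in>UNIV. rotation \<mu> y B u $ 1 $ k * \<phi> $ k $ \<alpha> * (v $ k - v $ 1))
       = weight \<mu> \<alpha> * \<phi> $ 1 $ \<alpha> * ((v $ 2 - v $ 1) / h) + Omega2 \<mu> y B x * \<phi> $ 3 $ \<alpha> / x * ((v $ 3 - v $ 1 - x * (v $ 2 - v $ 1)) / h)"
    "(\<Sum>k\<in>UNIV. rotation \<mu> y B u $ 2 $ k * \<phi> $ k $ \<alpha> * (v $ k - v $ 2))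
       = weight \<mu> \<alpha> * \<phi> $ 2 $ \<alpha> * ((v $ 2 - v $ 1) / h) + - Omega1 \<mu> y B x * \<phi> $ 3 $ \<alpha> / (x - 1) * ((v $ 3 - v $ 1 - x * (v $ 2 - v $ 1)) / h)"
    "(\<Sum>k\<in>UNIV. rotation \<mu> y B u $ 3 $ k * \<phi> $ k $ \<alpha> * (v $ k - v $ 3))
       = weight \<mu> \<alpha> * \<phi> $ 3 $ \<alpha> * ((v $ 2 - v $ 1) / h) + (- Omega2 \<mu> y B x * \<phi> $ 1 $ \<alpha> / x + Omega1 \<mu> y B x * \<phi> $ 2 $ \<alpha> / (x - 1))
          * ((v $ 3 - v $ 1 - x * (v $ 2 - v $ 1)) / h)" for v :: "complex ^ 3" and \<alpha>
    unfolding frame_deriv_identities[OF nz h(1) salg(2-4), folded \<phi>_def, symmetric]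
    by (simp_all add: sum_3 rot Let_def)
  show "(\<Sum>k\<in>UNIV. rotation \<mu> y B u $ j $ k * frame \<mu> y B g u $ k $ \<alpha> * (u $ k - u $ j)) = weight \<mu> \<alpha> * frame \<mu> y B g u $ j $ \<alpha>" for j \<alpha>
  proof -
    \<comment> \<open>On the Euler field dx vanishes, the ratio having degree 0, while dH/H equals
      1; only the weight survives.\<close>
    have "u $ 3 - u $ 1 - x * (u $ 2 - u $ 1) = 0" "(u $ 2 - u $ 1) / h = 1" using h by simp_all
    then have "(\<Sum>k\<in>UNIV. rotation \<mu> y B u $ j $ k * \<phi> $ k $ \<alpha> * (u $ k - u $ j)) = weight \<mu> \<alpha> * \<phi> $ j $ \<alpha>"
      using exhaust_3[of j] ralg[of \<alpha> u] by (elim disjE) (simp_all only: div_0 mult_zero_right mult_1_right add_0_right)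
    moreover have "(\<Sum>k\<in>UNIV. rotation \<mu> y B u $ j $ k * frame \<mu> y B g u $ k $ \<alpha> * (u $ k - u $ j))
       = (\<Sum>k\<in>UNIV. rotation \<mu> y B u $ j $ k * \<phi> $ k $ \<alpha> * (u $ k - u $ j)) * p \<alpha>"
      unfolding fr sum_distrib_right by (simp add: mult_ac)
    ultimately show ?thesis by (simp add: fr mult_ac)
  qed
  show "((\<lambda>u. frame \<mu> y B g u $ j $ \<alpha>) has_derivative
      (\<lambda>v. \<Sum>k\<in>UNIV. rotation \<mu> y B u $ j $ k * frame \<mu> y B g u $ k $ \<alpha> * (v $ k - v $ j))) (at u)" for j \<alpha>
  proof -
    note dr = ratio_has_derivative[OF u12, folded x_def h_def]
    have "(log_H B has_field_derivative 1 / h) (at h)"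
      using adm hL unfolding admissible_branches_def by (intro log_branch_has_field_derivative[OF L]) auto
    then have "((\<lambda>H. H_power B H (weight \<mu> \<alpha>)) has_field_derivative p \<alpha> * (weight \<mu> \<alpha> * (1 / h))) (at h)"
      unfolding H_power_def p_def by (intro DERIV_chain2[OF DERIV_exp] DERIV_cmult)
    then have dp: "((\<lambda>u. H_power B (diff21 u) (weight \<mu> \<alpha>)) has_derivative
         (\<lambda>v. p \<alpha> * (weight \<mu> \<alpha> * (1 / h)) * (v $ 2 - v $ 1))) (at u)"
      unfolding has_field_derivative_def h_def by (intro has_derivative_compose[OF dr(2)])
    have main: "((\<lambda>u. frame \<mu> y B g u $ j $ \<alpha>) has_derivative (\<lambda>v. p \<alpha> * (weight \<mu> \<alpha> * \<phi> $ j $ \<alpha> * ((v $ 2 - v $ 1) / h)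
         + d * ((v $ 3 - v $ 1 - x * (v $ 2 - v $ 1)) / h)))) (at u)"
      if "((\<lambda>x. scaled_E \<mu> y B g x $ j $ \<alpha>) has_field_derivative d) (at x)" for d
    proof -
      have "((\<lambda>u. scaled_E \<mu> y B g (ratio u) $ j $ \<alpha>) has_derivative (\<lambda>v. d * ((v $ 3 - v $ 1 - x * (v $ 2 - v $ 1)) / h))) (at u)"
        using that unfolding has_field_derivative_def x_def by (intro has_derivative_compose[OF dr(1)[unfolded x_def]])
      from has_derivative_mult[OF this dp] show ?thesis
        unfolding frame_def vec_lambda_beta
        by (rule has_derivative_eq_rhs) (simp add: fun_eq_iff \<phi>_def p_def x_def h_def algebra_simps)
    qed
    have "(\<Sum>k\<in>UNIV. rotation \<mu> y B u $ j $ k * frame \<mu> y B g u $ k $ \<alpha> * (v $ k - v $ j))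
       = p \<alpha> * (\<Sum>k\<in>UNIV. rotation \<mu> y B u $ j $ k * \<phi> $ k $ \<alpha> * (v $ k - v $ j))" for v
      unfolding fr sum_distrib_left by (simp add: mult_ac)
    then show ?thesis
      using exhaust_3[of j] main sder[of \<alpha>, folded \<phi>_def]
      by (elim disjE) (simp_all only: ralg)
  qed
qed

section \<open>The parametric representation near a point\<close>

theorem mainTheorem4:
  fixes \<mu> k0 :: complex
    and y :: "complex \<Rightarrow> complex"
    and X L :: "complex set"
    and B :: branches
    and u0 :: "complex ^ 3"
  assumes "\<mu> \<noteq> 0"
    and "\<mu> \<notin> {1/2, -1/2, 1, -1, 3/2, -3/2, 2, -2, 3, -3}"
    and "PVI_solution_on \<mu> X y"
    and "k0 \<noteq> 0"
    and "open L"
    and "admissible_branches \<mu> k0 y X L B"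
    and "u0 $ 1 \<noteq> u0 $ 2" "u0 $ 2 \<noteq> u0 $ 3" "u0 $ 1 \<noteq> u0 $ 3"
    and "ratio u0 \<in> X" "diff21 u0 \<in> L"
    and "E \<mu> y B (ratio u0) $ 1 $ 1 * E \<mu> y B (ratio u0) $ 2 $ 1 * E \<mu> y B (ratio u0) $ 3 $ 1 \<noteq> 0"
  shows "\<exists>U F \<tau>2 \<tau>3 \<F>.
    open U \<and> u0 \<in> U \<and>
    (\<forall>u\<in>U. u $ 1 \<noteq> u $ 2 \<and> u $ 2 \<noteq> u $ 3 \<and> u $ 1 \<noteq> u $ 3 \<and> ratio u \<in> X \<and> diff21 u \<in> L) \<and>
    biholomorphic_on (flat_coords \<mu> y B) U \<and>
    (\<forall>u\<in>U. F (flat_coords \<mu> y B u) = potential \<mu> y B u) \<and>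
    WDVV_solution (- 2 * \<mu>) (vector [0, - \<mu>, - 2 * \<mu>]) (flat_coords \<mu> y B ` U) F \<and>
    (\<forall>u\<in>U. let x = ratio u; H = diff21 u; t = flat_coords \<mu> y B u in
       t $ 2 = \<tau>2 x * H_power B H (1 + \<mu>) \<and>
       t $ 3 = \<tau>3 x * H_power B H (1 + 2 * \<mu>) \<and>
       potential \<mu> y B u =
         1/2 * t $ 1 * (t $ 2)\<^sup>2 + 1/2 * (t $ 1)\<^sup>2 * t $ 3 + \<F> x * H_power B H (3 + 2 * \<mu>))"
proof -
  note mu = assms(1,2) and P = assms(3) and adm = assms(6) and u0 = assms(7-11)
  obtain N g where N: "open N" "u0 \<in> N"
    and dom: "\<And>u. u \<in> N \<Longrightarrow> u $ 1 \<noteq> u $ 2 \<and> u $ 2 \<noteq> u $ 3 \<and> u $ 1 \<noteq> u $ 3 \<and> ratio u \<in> X \<and> diff21 u \<in> L"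
    and E1: "\<And>u j. u \<in> N \<Longrightarrow> E \<mu> y B (ratio u) $ j $ 1 \<noteq> 0"
    and g0: "\<And>u. u \<in> N \<Longrightarrow> g (ratio u) \<noteq> 0"
    and f: "\<And>u. u \<in> N \<Longrightarrow> ffun B (ratio u) (diff21 u) = g (ratio u) * H_power B (diff21 u) (- \<mu>)"
    and dg: "\<And>u. u \<in> N \<Longrightarrow> (g has_field_derivative
       1/2 * ((2*\<mu> - 1) * (y (ratio u) - ratio u) / (ratio u * (ratio u - 1))
          + (2 * Afun y (ratio u) + y (ratio u) * (y (ratio u) - 1)) / (ratio u * (ratio u - 1)) / (y (ratio u) - 1)
          - 1/(ratio u - 1)) * g (ratio u)) (at (ratio u))"
    by (rule ffun_local_product[OF P adm assms(4,5) u0 mu(1) assms(12)]) blast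
  interpret fr: egoroff_frame N "frame \<mu> y B g" "rotation \<mu> y B" \<mu>
    by (rule egoroff_frame_of_PVI[OF P adm assms(5) N(1) mu _ E1 g0 dg]) (use dom in auto)
  have S: "fr.S 1 1 u = coef_c \<mu> y B (ratio u) * (diff21 u / (ffun B (ratio u) (diff21 u))\<^sup>2)"
      "fr.S 1 2 u = coef_b \<mu> y B (ratio u) * (diff21 u / ffun B (ratio u) (diff21 u))"
      "fr.S 1 3 u = u $ 1 + coef_a \<mu> y B (ratio u) * diff21 u"
      "fr.S 2 2 u = u $ 1 + coef_b2 \<mu> y B (ratio u) * diff21 u"
      "fr.S 2 3 u = coef_b1 \<mu> y B (ratio u) * (diff21 u * ffun B (ratio u) (diff21 u))"
      "fr.S 3 3 u = coef_a1 \<mu> y B (ratio u) * (diff21 u * (ffun B (ratio u) (diff21 u))\<^sup>2)"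
      and f0: "ffun B (ratio u) (diff21 u) \<noteq> 0" if u: "u \<in> N" for u
  proof -
    define x where "x = ratio u"
    define h where "h = diff21 u"
    define \<epsilon> where "\<epsilon> = E \<mu> y B x"
    define r where "r = ffun B x h"
    have xX: "x \<in> X" and u12: "u $ 1 \<noteq> u $ 2" using dom[OF u] by (auto simp: x_def)
    have E21: "\<epsilon> $ 2 $ 1 \<noteq> 0" using E1[OF u] by (simp add: \<epsilon>_def x_def)
    have r: "r = g x * H_power B h (- \<mu>)" using f[OF u] by (simp add: r_def x_def h_def)
    show "ffun B (ratio u) (diff21 u) \<noteq> 0" using f[OF u] g0[OF u] by simp
    then have r0: "r \<noteq> 0" by (simp add: r_def x_def h_def)
    have fr: "frame \<mu> y B g u $ j $ 1 = \<epsilon> $ j $ 1 / r" "frame \<mu> y B g u $ j $ 2 = \<epsilon> $ j $ 2"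
      "frame \<mu> y B g u $ j $ 3 = \<epsilon> $ j $ 3 * r" for j
      unfolding r by (simp_all add: frame_def scaled_E_entries \<epsilon>_def x_def[symmetric] h_def[symmetric] H_power_minus divide_inverse)
    \<comment> \<open>Orthogonality eliminates the first row, so u_1 appears only together with
      \<open>eta\<close> and H only with rows 2 and 3. This is why a, b, c and their companions are
      built from these two rows.\<close>
    have orth: "\<epsilon> $ 1 $ \<alpha> * \<epsilon> $ 1 $ \<beta> = eta $ \<alpha> $ \<beta> - \<epsilon> $ 2 $ \<alpha> * \<epsilon> $ 2 $ \<beta> - \<epsilon> $ 3 $ \<alpha> * \<epsilon> $ 3 $ \<beta>" for \<alpha> \<beta>
      using E_algebra(1)[OF P xX adm mu(1) E21[unfolded \<epsilon>_def], of \<alpha> \<beta>, folded \<epsilon>_def]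
      by (simp add: sum_3 algebra_simps)
    have "(\<Sum>j\<in>UNIV. u $ j * (\<epsilon> $ j $ \<alpha> * \<epsilon> $ j $ \<beta>))
        = u $ 1 * eta $ \<alpha> $ \<beta> + (\<epsilon> $ 2 $ \<alpha> * \<epsilon> $ 2 $ \<beta> + x * \<epsilon> $ 3 $ \<alpha> * \<epsilon> $ 3 $ \<beta>) * h" for \<alpha> \<beta>
      unfolding sum_3 orth ratio_diff21(2,3)[OF u12, folded x_def h_def] by (simp add: algebra_simps)
    note \<sigma> = this[unfolded sum_3]
    have "fr.S 1 1 u = (\<Sum>j\<in>UNIV. u $ j * (\<epsilon> $ j $ 1 * \<epsilon> $ j $ 1)) / r\<^sup>2"
      "fr.S 1 2 u = (\<Sum>j\<in>UNIV. u $ j * (\<epsilon> $ j $ 1 * \<epsilon> $ j $ 2)) / r"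
      "fr.S 1 3 u = (\<Sum>j\<in>UNIV. u $ j * (\<epsilon> $ j $ 1 * \<epsilon> $ j $ 3))"
      "fr.S 2 2 u = (\<Sum>j\<in>UNIV. u $ j * (\<epsilon> $ j $ 2 * \<epsilon> $ j $ 2))"
      "fr.S 2 3 u = (\<Sum>j\<in>UNIV. u $ j * (\<epsilon> $ j $ 2 * \<epsilon> $ j $ 3)) * r"
      "fr.S 3 3 u = (\<Sum>j\<in>UNIV. u $ j * (\<epsilon> $ j $ 3 * \<epsilon> $ j $ 3)) * r\<^sup>2"
      unfolding fr.S_def fr sum_divide_distrib sum_distrib_right
      using r0 by (simp_all add: power2_eq_square mult_ac)
    note S = this[unfolded sum_3 \<sigma>]
    note coef = coef_a_def coef_b_def coef_b1_def coef_a1_def coef_b2_def coef_c_def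
    show "fr.S 1 1 u = coef_c \<mu> y B (ratio u) * (diff21 u / (ffun B (ratio u) (diff21 u))\<^sup>2)"
      "fr.S 1 2 u = coef_b \<mu> y B (ratio u) * (diff21 u / ffun B (ratio u) (diff21 u))"
      "fr.S 1 3 u = u $ 1 + coef_a \<mu> y B (ratio u) * diff21 u"
      "fr.S 2 2 u = u $ 1 + coef_b2 \<mu> y B (ratio u) * diff21 u"
      "fr.S 2 3 u = coef_b1 \<mu> y B (ratio u) * (diff21 u * ffun B (ratio u) (diff21 u))"
      "fr.S 3 3 u = coef_a1 \<mu> y B (ratio u) * (diff21 u * (ffun B (ratio u) (diff21 u))\<^sup>2)"
      unfolding S coef x_def[symmetric] h_def[symmetric] \<epsilon>_def[symmetric] r_def[symmetric]
      by (simp_all add: power2_eq_square mult_ac)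
  qed
  have t: "fr.t u = flat_coords \<mu> y B u" if "u \<in> N" for u
    by (simp add: vec_eq_iff forall_3 fr.t_def fr.H_def flat_coords_def Let_def S[OF that] algebra_simps)
  have F: "fr.F u = potential \<mu> y B u" if u: "u \<in> N" for u
  proof -
    define h where "h = diff21 u"
    define r where "r = ffun B (ratio u) h"
    define K where "K = h ^ 3 / r\<^sup>2"
    have r: "r \<noteq> 0" using f0[OF u] by (simp add: r_def h_def)
    have *: "(c * (h / r\<^sup>2))\<^sup>2 * (a1 * (h * r\<^sup>2)) = a1 * c\<^sup>2 * (h ^ 3 / r\<^sup>2)"
      "b * (h / r) * (c * (h / r\<^sup>2)) * (b1 * (h * r)) = b * b1 * c * (h ^ 3 / r\<^sup>2)"
      "(b * (h / r))\<^sup>2 * ((u1 + b2 * h) - (u1 + a * h)) = b\<^sup>2 * (b2 - a) * (h ^ 3 / r\<^sup>2)"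
      for a b c a1 b1 b2 u1
      using r by (simp_all add: power2_eq_square power3_eq_cube field_simps)
    have "(c * (h / r\<^sup>2))\<^sup>2 * (a1 * (h * r\<^sup>2)) / d1 + w * (b * (h / r) * (c * (h / r\<^sup>2)) * (b1 * (h * r))) / d2
        + (b * (h / r))\<^sup>2 * ((u1 + b2 * h) - (u1 + a * h)) / d3
      = (a1 * c\<^sup>2 / d1 + w * b * b1 * c / d2 + b\<^sup>2 * (b2 - a) / d3) * (h ^ 3 / r\<^sup>2)"
      for a b c a1 b1 b2 u1 d1 d2 d3 w
      unfolding * K_def[symmetric] by (simp add: distrib_left mult_ac)
    then show ?thesis
      unfolding fr.F_eq t[OF u] S[OF u] potential_def Let_def h_def[symmetric] r_def[symmetric]
      by (simp only:)
  qed
  obtain W Fh where W: "open W" "u0 \<in> W" "W \<subseteq> N" "biholomorphic_on fr.t W"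
    and Fh: "\<And>u. u \<in> W \<Longrightarrow> Fh (fr.t u) = fr.F u"
    and sol: "WDVV_solution (- 2 * \<mu>) (vector [0, - \<mu>, - 2 * \<mu>]) (fr.t ` W) Fh"
    by (rule fr.WDVV_solution_locally[OF N(2)]) blast
  have WN: "u \<in> N" if "u \<in> W" for u using that W(3) by blast
  have im: "fr.t ` W = flat_coords \<mu> y B ` W" using t WN by auto
  \<comment> \<open>Since f = g(x) H^(-\<mu>) near \<open>u0\<close>, each factor 1/f contributes
    1/g to the function of x and \<mu> to the exponent of H.\<close>
  define \<tau>2 where "\<tau>2 x = 1 / (1 + \<mu>) * coef_b \<mu> y B x / g x" for x
  define \<tau>3 where "\<tau>3 x = 1 / (1 + 2 * \<mu>) * coef_c \<mu> y B x / (g x)\<^sup>2" for x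
  define \<F> where "\<F> x = (coef_a1 \<mu> y B x * (coef_c \<mu> y B x)\<^sup>2 / (2 * (1 - 2 * \<mu>) * (3 + 2 * \<mu>))
        + (\<mu> + 4) * coef_b \<mu> y B x * coef_b1 \<mu> y B x * coef_c \<mu> y B x / (2 * (1 - \<mu>) * (2 + \<mu>) * (3 + 2 * \<mu>))
        + (coef_b \<mu> y B x)\<^sup>2 * (coef_b2 \<mu> y B x - coef_a \<mu> y B x) / ((2 + \<mu>) * (3 + 2 * \<mu>))) / (g x)\<^sup>2" for x
  have "let x = ratio u; H = diff21 u; t = flat_coords \<mu> y B u in
       t $ 2 = \<tau>2 x * H_power B H (1 + \<mu>) \<and>
       t $ 3 = \<tau>3 x * H_power B H (1 + 2 * \<mu>) \<and>
       potential \<mu> y B u =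
         1/2 * t $ 1 * (t $ 2)\<^sup>2 + 1/2 * (t $ 1)\<^sup>2 * t $ 3 + \<F> x * H_power B H (3 + 2 * \<mu>)" if "u \<in> W" for u
  proof -
    have u: "u \<in> N" using that by (rule WN)
    have h: "H_power B (diff21 u) 1 = diff21 u" using dom[OF u] H_power_one[OF adm] by blast
    define p where "p = H_power B (diff21 u) \<mu>"
    have "p \<noteq> 0" by (simp add: p_def)
    have f: "ffun B (ratio u) (diff21 u) = g (ratio u) / p"
      using f[OF u] by (simp add: H_power_minus p_def divide_inverse)
    \<comment> \<open>The exponents are spelled out as sums of 1 and \<mu> so that the addition law
      splits them completely.\<close>
    have "H_power B (diff21 u) (1 + \<mu>) = diff21 u * p"
      "H_power B (diff21 u) (1 + (\<mu> + \<mu>)) = diff21 u * p\<^sup>2"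
      "H_power B (diff21 u) (1 + (1 + (1 + (\<mu> + \<mu>)))) = diff21 u ^ 3 * p\<^sup>2"
      unfolding H_power_add h p_def by (simp_all add: power2_eq_square power3_eq_cube)
    then have pw: "H_power B (diff21 u) (1 + \<mu>) = diff21 u * p"
      "H_power B (diff21 u) (1 + 2 * \<mu>) = diff21 u * p\<^sup>2"
      "H_power B (diff21 u) (3 + 2 * \<mu>) = diff21 u ^ 3 * p\<^sup>2"
      by (simp_all flip: mult_2)
    have q: "z * (diff21 u / (g (ratio u) / p)) = z / g (ratio u) * (diff21 u * p)"
      "z * (diff21 u / (g (ratio u) / p)\<^sup>2) = z / (g (ratio u))\<^sup>2 * (diff21 u * p\<^sup>2)"
      "z * (diff21 u ^ 3 / (g (ratio u) / p)\<^sup>2) = z / (g (ratio u))\<^sup>2 * (diff21 u ^ 3 * p\<^sup>2)" for z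
      by (simp_all add: power_divide)
    show ?thesis
      unfolding Let_def potential_def flat_coords_def f pw vector_3 q \<tau>2_def \<tau>3_def \<F>_def
      by simp
  qed
  moreover have "biholomorphic_on (flat_coords \<mu> y B) W"
    by (rule biholomorphic_on_cong[OF _ W(4)]) (use t WN in auto)
  moreover have "Fh (flat_coords \<mu> y B u) = potential \<mu> y B u" if "u \<in> W" for u
    using Fh[OF that] t[OF WN[OF that]] F[OF WN[OF that]] by simp
  ultimately show ?thesis
    using W(1,2) sol[unfolded im] dom[OF WN]
    by (intro exI[of _ W] exI[of _ Fh] exI[of _ \<tau>2] exI[of _ \<tau>3] exI[of _ \<F>] conjI ballI) auto
qed

end
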